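(* The difference between $\mathrm{lsfw}$ and $\mathrm{sfw}$ is unbounded, even on trees: for every integer $N$ there is a tree $T$ with $\mathrm{lsfw}(T)-\mathrm{sfw}(T)\ge N$. More precisely, every forest $F$ satisfies $$\mathrm{lsfw}(F)\ge 2\,\mathrm{pw}(F),$$ where $\mathrm{pw}$ denotes path-width, while every tree $T$ satisfies $\mathrm{sfw}(T)\le 4$.
   Context: All graphs are finite, simple and undirected. Both $\mathrm{sfw}$ and $\mathrm{lsfw}$ are assigned value $0$ on the empty graph. Split-free cable expressions. A cable is a nonempty set of vertices treated as one indivisible live unit. A split-free cable expression is a typed term; a term of type $p\to q$ receives $p$ ordered live cables and returns $q$ ordered live cables, and its cable rank is $\mathrm{cr}(p\to q)=p+q$. The generators are: $e:1\to1$ (keep one cable unchanged); $\nu_S:0\to1$ (birth a fresh nonempty vertex set $S$ as one cable); $\kappa:1\to0$ (close, i.e. remove, one cable); $\varphi:2\to1$ (fold two cables into their union); $B:2\to2$ (add all edges between the two cables, which both remain live); $K:1\to1$ (add all internal edges of the cable). Terms are combined by serial composition: if $s:p\to q$ and $t:q\to r$ then $s\circ t:p\to r$, where $s$ is performed before $t$; and by parallel product: if $s:p\to q$ and $t:p'\to q'$ then $s\mathbin{\Box}t:p+p'\to q+q'$, which executes the two terms on disjoint vertex sets and concatenates their output cables. Cable permutations are structural reindexings of the ordered interface; they create no vertices or edges and do not change cable rank. The value of a closed expression $t:0\to0$ is the graph on the born vertices whose edges are those added by its block ($B$) and clique ($K$) operations (edge additions use set union). A closed expression is legal for $G$ if every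 vertex is born exactly once, every added edge belongs to $G$, and the final graph is $G$. The width of an expression is the largest cable rank of a subterm occurrence, where the rank of a subterm is that of its own interface type in the parse tree (identity wires placed in parallel with a subterm are counted only in the enclosing subterm). $\mathrm{sfw}(G)$ is the minimum width of a legal closed expression for $G$. Sequential cable plays. A configuration on $G$ consists of the set of born vertices, a family $\mathcal L$ of pairwise disjoint nonempty sets of born vertices (the live cables), and a set of already placed edges; initially all are empty. With $\ell=|\mathcal L|$ the number of live cables before a move, the moves are: (i) birth$(S)$: introduces a nonempty set $S$ of fresh (not yet born) vertices of $G$ as one live cable; cost $2\ell+1$. (ii) fold$(X,Y)$: replaces two distinct live cables $X,Y$ by $X\cup Y$; cost $2\ell-1$. (iii) block$(X,Y)$: places every edge between two distinct live cables $X,Y$; legal when all these pairs are edges of $G$ and at least one has not already been placed; cost $2\ell$. (iv) clique$(X)$: places every edge inside a live cable $X$; legal when $X$ is a clique of $G$ and at least one internal edge has not already been placed; cost $2\ell$. (v) close$(X)$: removes the live cable $X$; legal when every edge of $G$ incident with a vertex of $X$ has already been placed; cost $2\ell-1$. A play (a finite sequence of legal moves from the initial configuration) constructs $G$ if every vertex is born, every edge of $G$ is placed, and every cable is closed. The width of a play is the maximum cost of its moves, and $\mathrm{lsfw}(G)$ is the minimum width of a play constructing $G$. *)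

theory Defs
  imports "HOL-Combinatorics.Permutations"
begin

section \<open>Finite simple graphs, trees and path-width\<close>

record 'a ugraph =
  verts :: "'a set"
  edges :: "'a set set"

definition simple_graph :: "'a ugraph \<Rightarrow> bool" where
  "simple_graph G \<longleftrightarrow> finite (verts G) \<and> (\<forall>e\<in>edges G. e \<subseteq> verts G \<and> card e = 2)"

definition is_cycle :: "'a ugraph \<Rightarrow> 'a list \<Rightarrow> bool" where
  "is_cycle G vs \<longleftrightarrow> 3 \<le> length vs \<and> distinct vs \<and>
     (\<forall>i<length vs. {vs ! i, vs ! (Suc i mod length vs)} \<in> edges G)"

definition forest :: "'a ugraph \<Rightarrow> bool" where
  "forest G \<longleftrightarrow> simple_graph G \<and> (\<nexists>vs. is_cycle G vs)"

definition connected :: "'a ugraph \<Rightarrow> bool" where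
  "connected G \<longleftrightarrow> verts G \<noteq> {} \<and>
     (\<forall>u\<in>verts G. \<forall>v\<in>verts G. (u, v) \<in> {(x, y). {x, y} \<in> edges G}\<^sup>*)"

definition tree :: "'a ugraph \<Rightarrow> bool" where
  "tree G \<longleftrightarrow> forest G \<and> connected G"

definition path_decomposition :: "'a ugraph \<Rightarrow> 'a set list \<Rightarrow> bool" where
  "path_decomposition G Bs \<longleftrightarrow> Bs \<noteq> [] \<and>
     \<Union> (set Bs) = verts G \<and>
     (\<forall>e\<in>edges G. \<exists>B\<in>set Bs. e \<subseteq> B) \<and>
     (\<forall>i j k. i \<le> j \<and> j \<le> k \<and> k < length Bs \<longrightarrow> Bs ! i \<inter> Bs ! k \<subseteq> Bs ! j)"

text \<open>The subtraction truncates only for the empty graph, whose path-width is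
  thereby \<open>0\<close>, not \<open>-1\<close>.\<close>

definition decomposition_width :: "'a set list \<Rightarrow> nat" where
  "decomposition_width Bs = Max (card ` set Bs) - 1"

definition pathwidth :: "'a ugraph \<Rightarrow> nat" where
  "pathwidth G = (LEAST w. \<exists>Bs. path_decomposition G Bs \<and> decomposition_width Bs = w)"


section \<open>Edges added by block and clique operations\<close>

definition block_edges :: "'a set \<Rightarrow> 'a set \<Rightarrow> 'a set set" where
  "block_edges X Y = {{x, y} | x y. x \<in> X \<and> y \<in> Y}"

definition clique_edges :: "'a set \<Rightarrow> 'a set set" where
  "clique_edges X = {{x, y} | x y. x \<in> X \<and> y \<in> X \<and> x \<noteq> y}"


section \<open>Split-free cable expressions\<close>

text \<open>Cable permutations are structural, not generators: a term may have its input and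
  output cables permuted, and the reindexed term has the interface type (hence the cable
  rank) of the original one. In particular a bare permutation of \<open>p\<close> cables is not
  charged as a subterm of rank \<open>2 * p\<close>.\<close>

datatype 'a cable_expr =
    Keep
  | Birth "'a set"
  | Close
  | Fold
  | Block
  | Clique
  | Serial "'a cable_expr" "'a cable_expr"
  | Parallel "'a cable_expr" "'a cable_expr"
  | Reindex "nat \<Rightarrow> nat" "'a cable_expr" "nat \<Rightarrow> nat"

primrec arity_in :: "'a cable_expr \<Rightarrow> nat" where
  "arity_in Keep = 1"
| "arity_in (Birth S) = 0"
| "arity_in Close = 1"
| "arity_in Fold = 2"
| "arity_in Block = 2"
| "arity_in Clique = 1"
| "arity_in (Serial s t) = arity_in s"
| "arity_in (Parallel s t) = arity_in s + arity_in t"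
| "arity_in (Reindex \<pi> t \<rho>) = arity_in t"

primrec arity_out :: "'a cable_expr \<Rightarrow> nat" where
  "arity_out Keep = 1"
| "arity_out (Birth S) = 1"
| "arity_out Close = 0"
| "arity_out Fold = 1"
| "arity_out Block = 2"
| "arity_out Clique = 1"
| "arity_out (Serial s t) = arity_out t"
| "arity_out (Parallel s t) = arity_out s + arity_out t"
| "arity_out (Reindex \<pi> t \<rho>) = arity_out t"

primrec well_typed :: "'a cable_expr \<Rightarrow> bool" where
  "well_typed Keep \<longleftrightarrow> True"
| "well_typed (Birth S) \<longleftrightarrow> S \<noteq> {}"
| "well_typed Close \<longleftrightarrow> True"
| "well_typed Fold \<longleftrightarrow> True"
| "well_typed Block \<longleftrightarrow> True"
| "well_typed Clique \<longleftrightarrow> True"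
| "well_typed (Serial s t) \<longleftrightarrow> well_typed s \<and> well_typed t \<and> arity_out s = arity_in t"
| "well_typed (Parallel s t) \<longleftrightarrow> well_typed s \<and> well_typed t"
| "well_typed (Reindex \<pi> t \<rho>) \<longleftrightarrow>
     well_typed t \<and> \<pi> permutes {..<arity_in t} \<and> \<rho> permutes {..<arity_out t}"

definition cable_rank :: "'a cable_expr \<Rightarrow> nat" where
  "cable_rank t = arity_in t + arity_out t"

primrec subterms :: "'a cable_expr \<Rightarrow> 'a cable_expr set" where
  "subterms Keep = {Keep}"
| "subterms (Birth S) = {Birth S}"
| "subterms Close = {Close}"
| "subterms Fold = {Fold}"
| "subterms Block = {Block}"
| "subterms Clique = {Clique}"
| "subterms (Serial s t) = insert (Serial s t) (subterms s \<union> subterms t)"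
| "subterms (Parallel s t) = insert (Parallel s t) (subterms s \<union> subterms t)"
| "subterms (Reindex \<pi> t \<rho>) = insert (Reindex \<pi> t \<rho>) (subterms t)"

definition expr_width :: "'a cable_expr \<Rightarrow> nat" where
  "expr_width t = Max (cable_rank ` subterms t)"

primrec birth_count :: "'a cable_expr \<Rightarrow> 'a \<Rightarrow> nat" where
  "birth_count Keep v = 0"
| "birth_count (Birth S) v = (if v \<in> S then 1 else 0)"
| "birth_count Close v = 0"
| "birth_count Fold v = 0"
| "birth_count Block v = 0"
| "birth_count Clique v = 0"
| "birth_count (Serial s t) v = birth_count s v + birth_count t v"
| "birth_count (Parallel s t) v = birth_count s v + birth_count t v"
| "birth_count (Reindex \<pi> t \<rho>) v = birth_count t v"

text \<open>The list of output cables and the set of added edges, given the list of input cables.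
  Meaningful for well-typed terms applied to \<open>arity_in\<close> many cables.\<close>

primrec run_expr :: "'a cable_expr \<Rightarrow> 'a set list \<Rightarrow> 'a set list \<times> 'a set set" where
  "run_expr Keep Xs = (Xs, {})"
| "run_expr (Birth S) Xs = ([S], {})"
| "run_expr Close Xs = ([], {})"
| "run_expr Fold Xs = ([Xs ! 0 \<union> Xs ! 1], {})"
| "run_expr Block Xs = (Xs, block_edges (Xs ! 0) (Xs ! 1))"
| "run_expr Clique Xs = (Xs, clique_edges (Xs ! 0))"
| "run_expr (Serial s t) Xs =
     (let (Ys, E) = run_expr s Xs; (Zs, F) = run_expr t Ys in (Zs, E \<union> F))"
| "run_expr (Parallel s t) Xs =
     (let (Ys, E) = run_expr s (take (arity_in s) Xs);
          (Zs, F) = run_expr t (drop (arity_in s) Xs)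
      in (Ys @ Zs, E \<union> F))"
| "run_expr (Reindex \<pi> t \<rho>) Xs =
     (let (Ys, E) = run_expr t (permute_list \<pi> Xs) in (permute_list \<rho> Ys, E))"

definition closed_expr :: "'a cable_expr \<Rightarrow> bool" where
  "closed_expr t \<longleftrightarrow> well_typed t \<and> arity_in t = 0 \<and> arity_out t = 0"

definition expr_graph :: "'a cable_expr \<Rightarrow> 'a ugraph" where
  "expr_graph t = \<lparr>verts = {v. 0 < birth_count t v}, edges = snd (run_expr t [])\<rparr>"

definition legal_expr :: "'a ugraph \<Rightarrow> 'a cable_expr \<Rightarrow> bool" where
  "legal_expr G t \<longleftrightarrow> closed_expr t \<and>
     (\<forall>v\<in>verts G. birth_count t v = 1) \<and>
     snd (run_expr t []) \<subseteq> edges G \<and>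
     expr_graph t = G"

definition sfw :: "'a ugraph \<Rightarrow> nat" where
  "sfw G = (if verts G = {} then 0
            else LEAST w. \<exists>t. legal_expr G t \<and> expr_width t = w)"


section \<open>Sequential cable plays\<close>

record 'a config =
  born :: "'a set"
  live :: "'a set set"
  placed :: "'a set set"

definition initial_config :: "'a config" where
  "initial_config = \<lparr>born = {}, live = {}, placed = {}\<rparr>"

datatype 'a move =
    BirthMove "'a set"
  | FoldMove "'a set" "'a set"
  | BlockMove "'a set" "'a set"
  | CliqueMove "'a set"
  | CloseMove "'a set"

primrec legal_move :: "'a ugraph \<Rightarrow> 'a config \<Rightarrow> 'a move \<Rightarrow> bool" where
  "legal_move G c (BirthMove S) \<longleftrightarrow> S \<noteq> {} \<and> S \<subseteq> verts G - born c"
| "legal_move G c (FoldMove X Y) \<longleftrightarrow> X \<in> live c \<and> Y \<in> live c \<and> X \<noteq> Y"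
| "legal_move G c (BlockMove X Y) \<longleftrightarrow> X \<in> live c \<and> Y \<in> live c \<and> X \<noteq> Y \<and>
     block_edges X Y \<subseteq> edges G \<and> \<not> block_edges X Y \<subseteq> placed c"
| "legal_move G c (CliqueMove X) \<longleftrightarrow> X \<in> live c \<and>
     clique_edges X \<subseteq> edges G \<and> \<not> clique_edges X \<subseteq> placed c"
| "legal_move G c (CloseMove X) \<longleftrightarrow> X \<in> live c \<and>
     (\<forall>e\<in>edges G. e \<inter> X \<noteq> {} \<longrightarrow> e \<in> placed c)"

primrec make_move :: "'a config \<Rightarrow> 'a move \<Rightarrow> 'a config" where
  "make_move c (BirthMove S) = c\<lparr>born := born c \<union> S, live := insert S (live c)\<rparr>"
| "make_move c (FoldMove X Y) = c\<lparr>live := insert (X \<union> Y) (live c - {X, Y})\<rparr>"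
| "make_move c (BlockMove X Y) = c\<lparr>placed := placed c \<union> block_edges X Y\<rparr>"
| "make_move c (CliqueMove X) = c\<lparr>placed := placed c \<union> clique_edges X\<rparr>"
| "make_move c (CloseMove X) = c\<lparr>live := live c - {X}\<rparr>"

text \<open>Legal fold and close moves need a live cable, so the subtraction does not truncate
  for them.\<close>

primrec move_cost :: "'a config \<Rightarrow> 'a move \<Rightarrow> nat" where
  "move_cost c (BirthMove S) = 2 * card (live c) + 1"
| "move_cost c (FoldMove X Y) = 2 * card (live c) - 1"
| "move_cost c (BlockMove X Y) = 2 * card (live c)"
| "move_cost c (CliqueMove X) = 2 * card (live c)"
| "move_cost c (CloseMove X) = 2 * card (live c) - 1"

primrec legal_play :: "'a ugraph \<Rightarrow> 'a config \<Rightarrow> 'a move list \<Rightarrow> bool" where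
  "legal_play G c [] \<longleftrightarrow> True"
| "legal_play G c (m # ms) \<longleftrightarrow> legal_move G c m \<and> legal_play G (make_move c m) ms"

primrec play_costs :: "'a config \<Rightarrow> 'a move list \<Rightarrow> nat list" where
  "play_costs c [] = []"
| "play_costs c (m # ms) = move_cost c m # play_costs (make_move c m) ms"

definition constructs :: "'a move list \<Rightarrow> 'a ugraph \<Rightarrow> bool" where
  "constructs ms G \<longleftrightarrow> legal_play G initial_config ms \<and>
     foldl make_move initial_config ms = \<lparr>born = verts G, live = {}, placed = edges G\<rparr>"

definition play_width :: "'a move list \<Rightarrow> nat" where
  "play_width ms = Max (set (play_costs initial_config ms))"

definition lsfw :: "'a ugraph \<Rightarrow> nat" where
  "lsfw G = (if verts G = {} then 0
             else LEAST w. \<exists>ms. constructs ms G \<and> play_width ms = w)"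

end

theory Submission
  imports Defs "HOL-Library.Transitive_Closure_Table"
begin

text \<open>
  For trees, width \<open>4\<close> suffices because a parallel product does not charge for the cables of
  its surroundings: splitting a tree at an edge \<open>rc\<close>, the parts containing \<open>r\<close> and \<open>c\<close> are built
  side by side as terms \<open>0 \<rightarrow> 1\<close>, the two surviving cables are joined, and \<open>c\<close> is closed.

  A play on a forest is turned into a path decomposition with bags of size at most \<open>w div 2 + 1\<close>,
  where \<open>w\<close> is the width of the play. A live cable that is a single vertex is represented by this
  vertex. A cable with at least two vertices has at most one common neighbour, since there are no
  \<open>4\<close>-cycles, and all its unplaced edges lead to that neighbour (or the cable is itself an
  unplaced edge); it is represented by the neighbour, possibly long before the neighbour is born.
  Only cables meeting a placed edge are represented. Their number grows only at block and clique
  moves, which cost \<open>2 * l\<close> with \<open>l\<close> live cables, or when the ends of an edge are folded, which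
  lowers the number of live cables. Hence there are at most \<open>w div 2\<close> representatives at any time,
  although the number of live cables may exceed this by one.

  Complete ternary trees have unbounded path-width: among three subtrees hanging off a common root,
  the bag that is wide in the middle one also meets the connected union of the root and the other two.
\<close>

section \<open>Trees have split-free width at most 4\<close>

lemma forest_mono:
  assumes "forest \<lparr>verts = V, edges = E\<rparr>" "V' \<subseteq> V" "E' \<subseteq> E" "\<And>e. e \<in> E' \<Longrightarrow> e \<subseteq> V'"
  shows "forest \<lparr>verts = V', edges = E'\<rparr>"
proof -
  have "is_cycle \<lparr>verts = V, edges = E\<rparr> vs" if "is_cycle \<lparr>verts = V', edges = E'\<rparr> vs" for vs
    using that assms(3) unfolding is_cycle_def by auto
  then show ?thesis
    using assms unfolding forest_def simple_graph_def by (auto intro: finite_subset)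
qed

lemma card_edge: "simple_graph G \<Longrightarrow> e \<in> edges G \<Longrightarrow> card e = 2"
  by (simp add: simple_graph_def)

lemma edge_neq: "simple_graph G \<Longrightarrow> {x, y} \<in> edges G \<Longrightarrow> x \<noteq> y"
  using card_edge by fastforce

lemma edge_subset_verts: "simple_graph G \<Longrightarrow> e \<in> edges G \<Longrightarrow> e \<subseteq> verts G"
  by (simp add: simple_graph_def)

section \<open>Components of a forest with one edge deleted\<close>

definition edge_rel :: "'a set set \<Rightarrow> ('a \<times> 'a) set" where
  "edge_rel E = {(x, y). {x, y} \<in> E}"

lemma edge_rel_iff [simp]: "(x, y) \<in> edge_rel E \<longleftrightarrow> {x, y} \<in> E"
  by (simp add: edge_rel_def)

lemma sym_edge_rel_rtrancl: "sym ((edge_rel E)\<^sup>*)"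
  by (rule sym_rtrancl) (auto simp: sym_def insert_commute)

lemma edge_rel_rtrancl_sym: "(x, y) \<in> (edge_rel E)\<^sup>* \<Longrightarrow> (y, x) \<in> (edge_rel E)\<^sup>*"
  using sym_edge_rel_rtrancl by (meson symD)

text \<open>A walk from \<open>r\<close> to \<open>c\<close> that avoids the edge
  \<open>{r, c}\<close> shortens to a path, which this edge closes to a cycle.\<close>

lemma forest_edge_is_bridge:
  assumes "forest G" and rc: "{r, c} \<in> edges G"
  shows "(r, c) \<notin> (edge_rel (edges G - {{r, c}}))\<^sup>*"
proof
  assume "(r, c) \<in> (edge_rel (edges G - {{r, c}}))\<^sup>*"
  then have "(\<lambda>x y. {x, y} \<in> edges G - {{r, c}})\<^sup>*\<^sup>* r c"
    by (simp add: rtranclp_rtrancl_eq edge_rel_def)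
  then obtain ys where "rtrancl_path (\<lambda>x y. {x, y} \<in> edges G - {{r, c}}) r ys c"
    by (auto simp: rtranclp_eq_rtrancl_path)
  then obtain xs where path: "rtrancl_path (\<lambda>x y. {x, y} \<in> edges G - {{r, c}}) r xs c"
    and dist: "distinct (r # xs)"
    by (rule rtrancl_path_distinct)
  have "r \<noteq> c" using edge_neq[OF _ rc] assms(1) by (simp add: forest_def)
  then have "xs \<noteq> []" using path by (auto elim: rtrancl_path.cases)
  then have last: "last xs = c" using path rtrancl_path_last by fastforce
  have step: "{(r # xs) ! i, xs ! i} \<in> edges G - {{r, c}}" if "i < length xs" for i
    using rtrancl_path_nth[OF path that] .
  \<comment> \<open>A path of one step would be the deleted edge itself, so the cycle has at least
    three vertices.\<close>
  have len: "2 \<le> length xs"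
  proof (rule ccontr)
    assume "\<not> 2 \<le> length xs"
    with \<open>xs \<noteq> []\<close> obtain x where "xs = [x]" by (cases xs) (auto simp: Suc_le_eq)
    with last step[of 0] show False by simp
  qed
  have "is_cycle G (r # xs)"
    unfolding is_cycle_def
  proof (intro conjI allI impI)
    fix i assume "i < length (r # xs)"
    then consider "i < length xs" | "i = length xs" by fastforce
    then show "{(r # xs) ! i, (r # xs) ! (Suc i mod length (r # xs))} \<in> edges G"
    proof cases
      case 1 then show ?thesis using step[of i] by simp
    next
      case 2
      then have "(r # xs) ! i = c" using \<open>xs \<noteq> []\<close> last
        by (simp add: last_conv_nth nth_Cons')
      then show ?thesis using rc 2 by (simp add: insert_commute)
    qed
  qed (use len dist in auto)
  then show False using assms by (auto simp: forest_def)
qed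

text \<open>All vertices on a walk from \<open>x\<close> are reachable from \<open>x\<close>, so a
  component is already connected by the edges inside it.\<close>

lemma edge_rel_rtrancl_within:
  assumes "(x, y) \<in> (edge_rel E)\<^sup>*"
  shows "(x, y) \<in> (edge_rel {e \<in> E. e \<subseteq> (edge_rel E)\<^sup>* `` {x}})\<^sup>*"
  using assms
proof (induction rule: rtrancl_induct)
  case (step y z)
  then have "{y, z} \<in> {e \<in> E. e \<subseteq> (edge_rel E)\<^sup>* `` {x}}"
    using rtrancl_into_rtrancl[of x y "edge_rel E" z] by auto
  then show ?case using step.IH by (auto intro: rtrancl_into_rtrancl)
qed simp

lemma tree_component:
  assumes F: "forest \<lparr>verts = V, edges = E\<rparr>" and "x \<in> V"
    and "E' \<subseteq> E" and C: "C = (edge_rel E')\<^sup>* `` {x}"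
  shows "tree \<lparr>verts = C, edges = {e \<in> E'. e \<subseteq> C}\<rparr>" and "C \<subseteq> V" and "x \<in> C"
proof -
  show "C \<subseteq> V"
  proof
    fix y assume "y \<in> C"
    then have "(x, y) \<in> (edge_rel E')\<^sup>*" using C by auto
    then show "y \<in> V"
      by cases (use assms edge_subset_verts[of "\<lparr>verts = V, edges = E\<rparr>"] in \<open>auto simp: forest_def\<close>)
  qed
  show "x \<in> C" using C by auto
  have "(u, v) \<in> (edge_rel {e \<in> E'. e \<subseteq> C})\<^sup>*" if "u \<in> C" "v \<in> C" for u v
  proof -
    have *: "(x, w) \<in> (edge_rel {e \<in> E'. e \<subseteq> C})\<^sup>*" if "w \<in> C" for w
      using that edge_rel_rtrancl_within[of x w E'] by (simp add: C)
    show ?thesis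
      by (rule rtrancl_trans[OF edge_rel_rtrancl_sym[OF *[OF that(1)]] *[OF that(2)]])
  qed
  moreover have "forest \<lparr>verts = C, edges = {e \<in> E'. e \<subseteq> C}\<rparr>"
    by (rule forest_mono[OF F \<open>C \<subseteq> V\<close>]) (use \<open>E' \<subseteq> E\<close> in auto)
  ultimately show "tree \<lparr>verts = C, edges = {e \<in> E'. e \<subseteq> C}\<rparr>"
    using \<open>x \<in> C\<close> unfolding tree_def connected_def edge_rel_def by auto
qed

text \<open>The two parts are the components of \<open>r\<close> and \<open>c\<close> after deleting
  \<open>{r, c}\<close>. They are disjoint because the edge is a bridge, and they exhaust
  \<open>V\<close> because every other edge stays within one component.\<close>

lemma tree_split_edge:
  assumes T: "tree \<lparr>verts = V, edges = E\<rparr>" and rc: "{r, c} \<in> E"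
  obtains V1 E1 V2 E2 where
    "tree \<lparr>verts = V1, edges = E1\<rparr>" "tree \<lparr>verts = V2, edges = E2\<rparr>" "r \<in> V1" "c \<in> V2"
    "V1 \<inter> V2 = {}" "V1 \<union> V2 = V" "E = insert {r, c} (E1 \<union> E2)" "{r, c} \<notin> E1 \<union> E2"
proof -
  define E' where "E' = E - {{r, c}}"
  define V1 where "V1 = (edge_rel E')\<^sup>* `` {r}"
  define V2 where "V2 = (edge_rel E')\<^sup>* `` {c}"
  have F: "forest \<lparr>verts = V, edges = E\<rparr>" and
    conn: "\<And>u v. u \<in> V \<Longrightarrow> v \<in> V \<Longrightarrow> (u, v) \<in> (edge_rel E)\<^sup>*"
    using T by (auto simp: tree_def connected_def edge_rel_def)
  have S: "simple_graph \<lparr>verts = V, edges = E\<rparr>" using F by (simp add: forest_def)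
  have rcV: "r \<in> V" "c \<in> V" using edge_subset_verts[OF S] rc by auto
  have "E' \<subseteq> E" by (auto simp: E'_def)
  note C1 = tree_component[OF F rcV(1) \<open>E' \<subseteq> E\<close> V1_def]
  note C2 = tree_component[OF F rcV(2) \<open>E' \<subseteq> E\<close> V2_def]
  have disj: "V1 \<inter> V2 = {}"
  proof (rule ccontr)
    assume "V1 \<inter> V2 \<noteq> {}"
    then obtain v where "(r, v) \<in> (edge_rel E')\<^sup>*" "(c, v) \<in> (edge_rel E')\<^sup>*"
      by (auto simp: V1_def V2_def)
    then have "(r, c) \<in> (edge_rel E')\<^sup>*"
      using edge_rel_rtrancl_sym by (meson rtrancl_trans)
    then show False using forest_edge_is_bridge[OF F] rc by (simp add: E'_def)
  qed
  have "v \<in> V1 \<union> V2" if "(r, v) \<in> (edge_rel E)\<^sup>*" for v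
    using that
  proof (induction rule: rtrancl_induct)
    case (step y z)
    show ?case
    proof (cases "{y, z} = {r, c}")
      case True then show ?thesis using C1(3) C2(3) by (auto simp: doubleton_eq_iff)
    next
      case False
      then have "(y, z) \<in> edge_rel E'" using step by (auto simp: E'_def)
      then show ?thesis using step.IH unfolding V1_def V2_def
        by (auto intro: rtrancl_into_rtrancl)
    qed
  qed (use C1 in auto)
  then have un: "V1 \<union> V2 = V" using conn rcV C1 C2 by blast
  have "e \<subseteq> V1 \<or> e \<subseteq> V2" if e: "e \<in> E'" for e
  proof -
    obtain x y where xy: "e = {x, y}"
      using card_edge[OF S, of e] e \<open>E' \<subseteq> E\<close> by (auto simp: card_2_iff)
    then have "(x, y) \<in> edge_rel E'" "(y, x) \<in> edge_rel E'"
      using e by (auto simp: insert_commute)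
    moreover have "x \<in> V" using edge_subset_verts[OF S, of e] e xy \<open>E' \<subseteq> E\<close> by auto
    ultimately show ?thesis using un xy unfolding V1_def V2_def
      by (auto intro: rtrancl_into_rtrancl)
  qed
  then have "E = insert {r, c} ({e \<in> E'. e \<subseteq> V1} \<union> {e \<in> E'. e \<subseteq> V2})"
    using rc by (auto simp: E'_def)
  then show thesis
    using that[OF C1(1) C2(1) C1(3) C2(3) disj un] by (auto simp: E'_def)
qed

section \<open>Cable terms for rooted trees\<close>

lemma expr_width_le_iff: "expr_width t \<le> k \<longleftrightarrow> (\<forall>s\<in>subterms t. cable_rank s \<le> k)"
proof -
  have "finite (subterms t)" "subterms t \<noteq> {}" by (induction t) auto
  then show ?thesis by (simp add: expr_width_def)
qed

text \<open>Induction on the number of edges. Only the root survives, as a singleton cable, so that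
  a single \<open>Block\<close> between two such terms adds exactly the edge that was cut.\<close>

lemma tree_cable_expr:
  assumes "tree \<lparr>verts = V, edges = E\<rparr>" "r \<in> V"
  shows "\<exists>t. well_typed t \<and> arity_in t = 0 \<and> arity_out t = 1 \<and> expr_width t \<le> 4 \<and>
    run_expr t [] = ([{r}], E) \<and> (\<forall>v. birth_count t v = (if v \<in> V then 1 else 0))"
  using assms
proof (induction "card E" arbitrary: V E r rule: less_induct)
  case less
  have F: "forest \<lparr>verts = V, edges = E\<rparr>" and
    conn: "\<And>u v. u \<in> V \<Longrightarrow> v \<in> V \<Longrightarrow> (u, v) \<in> (edge_rel E)\<^sup>*"
    using less.prems by (auto simp: tree_def connected_def edge_rel_def)
  have S: "simple_graph \<lparr>verts = V, edges = E\<rparr>" using F by (simp add: forest_def)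
  have "finite E"
    by (rule finite_subset[of _ "Pow V"]) (use S in \<open>auto simp: simple_graph_def\<close>)
  show ?case
  proof (cases "\<exists>c. {r, c} \<in> E")
    case False
    have "v = r" if "v \<in> V" for v
      using conn[OF less.prems(2) that] by (rule converse_rtranclE) (use False in auto)
    then have V: "V = {r}" using less.prems(2) by blast
    have "E = {}"
    proof (rule ccontr)
      assume "E \<noteq> {}"
      then obtain e where "e \<in> E" by auto
      then have "e \<subseteq> {r}" "card e = 2" using S V by (auto simp: simple_graph_def)
      then show False using card_mono[of "{r}" e] by simp
    qed
    then show ?thesis using V
      by (intro exI[of _ "Birth {r}"]) (simp add: expr_width_le_iff cable_rank_def)
  next
    case True
    then obtain c where rc: "{r, c} \<in> E" by auto
    obtain V1 E1 V2 E2 where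
      T: "tree \<lparr>verts = V1, edges = E1\<rparr>" "tree \<lparr>verts = V2, edges = E2\<rparr>" "r \<in> V1" "c \<in> V2"
      "V1 \<inter> V2 = {}" "V1 \<union> V2 = V" and E: "E = insert {r, c} (E1 \<union> E2)" "{r, c} \<notin> E1 \<union> E2"
      by (rule tree_split_edge[OF less.prems(1) rc])
    have "E1 \<subset> E" "E2 \<subset> E" using E by auto
    then have lt: "card E1 < card E" "card E2 < card E"
      using \<open>finite E\<close> psubset_card_mono by blast+
    obtain s where s: "well_typed s" "arity_in s = 0" "arity_out s = 1" "expr_width s \<le> 4"
      "run_expr s [] = ([{r}], E1)" "\<And>v. birth_count s v = (if v \<in> V1 then 1 else 0)"
      using less.hyps[OF lt(1) T(1,3)] by blast
    obtain t where t: "well_typed t" "arity_in t = 0" "arity_out t = 1" "expr_width t \<le> 4"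
      "run_expr t [] = ([{c}], E2)" "\<And>v. birth_count t v = (if v \<in> V2 then 1 else 0)"
      using less.hyps[OF lt(2) T(2,4)] by blast
    \<comment> \<open>Among the newly formed subterms only \<open>Block\<close> has rank 4; the two
      parallel products have ranks 2 and 3.\<close>
    let ?t = "Serial (Serial (Parallel s t) Block) (Parallel Keep Close)"
    have "expr_width ?t \<le> 4"
      using s(2-4) t(2-4) by (auto simp: expr_width_le_iff cable_rank_def)
    moreover have "run_expr ?t [] = ([{r}], E)"
      using s(2,5) t(2,5) E by (auto simp: block_edges_def)
    ultimately show ?thesis using s t T(5,6)
      by (intro exI[of _ ?t]) auto
  qed
qed

lemma sfw_tree_le_4:
  assumes "tree T"
  shows "sfw T \<le> 4"
proof -
  obtain V E where T: "T = \<lparr>verts = V, edges = E\<rparr>" by (cases T) auto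
  obtain r where r: "r \<in> V" using assms T by (auto simp: tree_def connected_def)
  obtain t where t: "well_typed t" "arity_in t = 0" "arity_out t = 1" "expr_width t \<le> 4"
    "run_expr t [] = ([{r}], E)" "\<And>v. birth_count t v = (if v \<in> V then 1 else 0)"
    using tree_cable_expr[of V E r] assms T r by blast
  let ?t = "Serial t Close"
  have "legal_expr T ?t"
    using t T by (auto simp: legal_expr_def closed_expr_def expr_graph_def)
  moreover have "expr_width ?t \<le> 4"
    using t(2-4) by (auto simp: expr_width_le_iff cable_rank_def)
  moreover have "verts T \<noteq> {}" using r T by auto
  ultimately show ?thesis unfolding sfw_def
    by (auto intro: order_trans[OF Least_le])
qed

section \<open>Ternary trees have unbounded path-width\<close>

text \<open>If bag \<open>j\<close> misses \<open>H\<close>, then by contiguity each vertex of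
  \<open>H\<close> occurs only before \<open>j\<close> or only after \<open>j\<close>. Adjacent
  vertices share a bag, so the side stays the same along the walk from \<open>u\<close>, and
  \<open>v\<close> cannot be in bag \<open>k\<close>.\<close>

lemma path_decomposition_hits:
  assumes Bs: "path_decomposition G Bs"
    and uv: "(u, v) \<in> {(x, y). x \<in> H \<and> y \<in> H \<and> {x, y} \<in> edges G}\<^sup>*"
    and ijk: "i \<le> j" "j \<le> k" "k < length Bs" and "u \<in> H" "u \<in> Bs ! i" "v \<in> Bs ! k"
  shows "Bs ! j \<inter> H \<noteq> {}"
proof
  assume disj: "Bs ! j \<inter> H = {}"
  have interval: "x \<in> Bs ! b" if "x \<in> Bs ! a" "x \<in> Bs ! c" "a \<le> b" "b \<le> c" "c < length Bs"
    for x a b c using Bs that unfolding path_decomposition_def by blast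
  have "v \<in> H \<and> (\<forall>l<length Bs. v \<in> Bs ! l \<longrightarrow> l < j)"
    using uv
  proof (induction rule: rtrancl_induct)
    case base
    show ?case
    proof (intro conjI allI impI)
      fix l assume "l < length Bs" "u \<in> Bs ! l"
      then show "l < j"
        using interval[of u i l j] ijk assms(6,7) disj by (meson disjoint_iff leI)
    qed fact
  next
    case (step y z)
    then have "z \<in> H" "{y, z} \<in> edges G" by auto
    then obtain m where m: "m < length Bs" "y \<in> Bs ! m" "z \<in> Bs ! m"
      using Bs unfolding path_decomposition_def by (metis in_set_conv_nth insert_subset)
    then have "m < j" using step.IH by auto
    have "l < j" if "l < length Bs" "z \<in> Bs ! l" for l
      using interval[of z m l j] m that \<open>m < j\<close> \<open>z \<in> H\<close> disj
      by (meson disjoint_iff leI less_imp_le)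
    then show ?case using \<open>z \<in> H\<close> by auto
  qed
  then show False using ijk assms(8) by auto
qed

lemma pathwidth_attained:
  assumes "simple_graph G"
  obtains Bs where "path_decomposition G Bs" "decomposition_width Bs = pathwidth G"
proof -
  have "path_decomposition G [verts G]"
    using assms by (auto simp: path_decomposition_def simple_graph_def)
  then show thesis
    using that LeastI_ex[of "\<lambda>w. \<exists>Bs. path_decomposition G Bs \<and> decomposition_width Bs = w"]
    unfolding pathwidth_def by blast
qed

text \<open>Heap indexing: the children of \<open>n\<close> are \<open>3 * n + 1\<close>, \<open>3 * n + 2\<close> and \<open>3 * n + 3\<close>.\<close>

definition heap_tree :: "nat \<Rightarrow> nat ugraph" where
  "heap_tree M = \<lparr>verts = {..<M}, edges = {{n, (n - 1) div 3} | n. 0 < n \<and> n < M}\<rparr>"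

text \<open>Both cyclic neighbours of the largest vertex on a cycle are smaller than it, hence equal
  to its parent, but the vertices of a cycle are distinct.\<close>

lemma heap_tree_not_cycle: "\<not> is_cycle (heap_tree M) vs"
proof
  assume cyc: "is_cycle (heap_tree M) vs"
  let ?L = "length vs"
  have L: "3 \<le> ?L" and dist: "distinct vs" and
    E: "\<And>i. i < ?L \<Longrightarrow> {vs ! i, vs ! (Suc i mod ?L)} \<in> edges (heap_tree M)"
    using cyc by (auto simp: is_cycle_def)
  have "Max (set vs) \<in> set vs" using L by (intro Max_in) auto
  then obtain i where i: "i < ?L" "vs ! i = Max (set vs)" by (metis in_set_conv_nth)
  have le: "vs ! j \<le> vs ! i" if "j < ?L" for j using that i by simp
  have parent: "w = (v - 1) div 3" if "{v, w} \<in> edges (heap_tree M)" "w \<le> v" for v w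
  proof -
    have "{v, w} \<in> {{n, (n - 1) div 3} | n. 0 < n \<and> n < M}"
      using that(1) by (simp only: heap_tree_def ugraph.select_convs)
    then obtain n where n: "0 < n" "{v, w} = {n, (n - 1) div 3}" by blast
    have "(n - 1) div 3 < n" using n by linarith
    then show ?thesis using n(2) that(2) by (auto simp: doubleton_eq_iff)
  qed
  \<comment> \<open>The cyclic predecessor \<open>j\<close> and successor \<open>k\<close> of
    \<open>i\<close> differ because the cycle has at least three vertices.\<close>
  define j where "j = (if i = 0 then ?L - 1 else i - 1)"
  define k where "k = Suc i mod ?L"
  have j: "j < ?L" "Suc j mod ?L = i" and k: "k < ?L" and jk: "j \<noteq> k"
    using i L by (auto simp: j_def k_def mod_Suc)
  have "vs ! k = (vs ! i - 1) div 3"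
    using parent[OF E[OF i(1)]] le[OF k] by (simp add: k_def)
  moreover have "vs ! j = (vs ! i - 1) div 3"
    using parent[of "vs ! i" "vs ! j"] E[OF j(1)] j le by (simp add: insert_commute)
  ultimately show False using dist j k jk nth_eq_iff_index_eq by metis
qed

lemma tree_heap_tree:
  assumes "0 < M"
  shows "tree (heap_tree M)"
proof -
  have "(n - 1) div 3 \<noteq> n" if "0 < n" for n :: nat using that by linarith
  then have "simple_graph (heap_tree M)"
    by (auto simp: simple_graph_def heap_tree_def card_insert_if)
  moreover have root: "(n, 0) \<in> {(x, y). {x, y} \<in> edges (heap_tree M)}\<^sup>*" if "n < M" for n
    using that
  proof (induction n rule: less_induct)
    case (less n)
    show ?case
    proof (cases "n = 0")
      case False
      then have "(n, (n - 1) div 3) \<in> {(x, y). {x, y} \<in> edges (heap_tree M)}"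
        using less.prems by (auto simp: heap_tree_def)
      moreover have "(n - 1) div 3 < n" using False by linarith
      ultimately show ?thesis using less by (meson converse_rtrancl_into_rtrancl less_trans)
    qed simp
  qed
  moreover have "sym ({(x, y). {x, y} \<in> edges (heap_tree M)}\<^sup>*)"
    by (rule sym_rtrancl) (auto simp: sym_def insert_commute)
  ultimately show ?thesis
    using assms heap_tree_not_cycle unfolding tree_def forest_def connected_def
    by (auto simp: heap_tree_def dest: symD) (metis (no_types, lifting) rtrancl_trans symD)
qed

primrec heap_subtree :: "nat \<Rightarrow> nat \<Rightarrow> nat set" where
  "heap_subtree 0 n = {n}"
| "heap_subtree (Suc d) n = insert n (\<Union>i\<in>{1, 2, 3}. heap_subtree d (3 * n + i))"

lemma root_in_heap_subtree [simp]: "n \<in> heap_subtree d n"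
  by (cases d) auto

lemma finite_heap_subtree [simp]: "finite (heap_subtree d n)"
  by (induction d arbitrary: n) auto

lemma heap_subtree_ge: "k \<in> heap_subtree d n \<Longrightarrow> n \<le> k"
  by (induction d arbitrary: n) fastforce+

text \<open>Translates membership into iterating the parent map, which makes disjointness of sibling
  subtrees a matter of arithmetic.\<close>

lemma heap_subtree_ancestor: "k \<in> heap_subtree d n \<Longrightarrow> \<exists>j. ((\<lambda>m. (m - 1) div 3) ^^ j) k = n"
proof (induction d arbitrary: n)
  case 0
  then show ?case by (intro exI[of _ 0]) auto
next
  case (Suc d)
  show ?case
  proof (cases "k = n")
    case True
    then show ?thesis by (intro exI[of _ 0]) auto
  next
    case False
    then obtain i where i: "i \<in> {1, 2, 3}" "k \<in> heap_subtree d (3 * n + i)"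
      using Suc.prems(1) unfolding heap_subtree.simps by blast
    then obtain j where "((\<lambda>m. (m - 1) div 3) ^^ j) k = 3 * n + i" using Suc.IH by blast
    then have "((\<lambda>m. (m - 1) div 3) ^^ Suc j) k = n" using i by auto
    then show ?thesis by blast
  qed
qed

text \<open>From a common vertex both siblings would be reached by climbing, so one sibling would be
  an ancestor of the other. But the first step up from a sibling leads to \<open>n\<close>, and
  later steps never exceed \<open>n\<close>.\<close>

lemma heap_subtree_disjoint:
  assumes "a \<in> {1, 2, 3}" "b \<in> {1, 2, 3}" "a \<noteq> b"
  shows "heap_subtree d (3 * n + a) \<inter> heap_subtree d (3 * n + b) = {}"
proof -
  let ?p = "\<lambda>m::nat. (m - 1) div 3"
  have dec: "(?p ^^ j) m \<le> m" for j m
  proof (induction j)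
    case (Suc j)
    have "?p ((?p ^^ j) m) \<le> (?p ^^ j) m" by linarith
    then show ?case using Suc by simp
  qed simp
  have *: "(?p ^^ j) (3 * n + a) \<noteq> 3 * n + b" if "a \<in> {1, 2, 3}" "b \<in> {1, 2, 3}" "a \<noteq> b" for j a b
  proof (cases j)
    case (Suc i)
    have "?p (3 * n + a) = n" using that by auto
    then have "(?p ^^ j) (3 * n + a) = (?p ^^ i) n" by (simp add: Suc funpow_Suc_right del: funpow.simps)
    then show ?thesis using dec[of i n] that by auto
  qed (use that in auto)
  show ?thesis
  proof (rule ccontr)
    assume "heap_subtree d (3 * n + a) \<inter> heap_subtree d (3 * n + b) \<noteq> {}"
    then obtain k i j where ij: "(?p ^^ i) k = 3 * n + a" "(?p ^^ j) k = 3 * n + b"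
      using heap_subtree_ancestor by (metis disjoint_iff)
    show False
    proof (cases "i \<le> j")
      case True
      then have "(?p ^^ (j - i)) (3 * n + a) = 3 * n + b"
        using ij by (metis comp_apply funpow_add le_add_diff_inverse2)
      then show False using *[of a b] assms by auto
    next
      case False
      then have "(?p ^^ (i - j)) (3 * n + b) = 3 * n + a"
        using ij by (metis comp_apply funpow_add le_add_diff_inverse2 nat_le_linear)
      then show False using *[of b a] assms by auto
    qed
  qed
qed

text \<open>Supplies the walks inside \<open>H\<close> that \<open>path_decomposition_hits\<close>
  asks for.\<close>

lemma heap_subtree_connected:
  assumes "k \<in> heap_subtree d n" "heap_subtree d n \<subseteq> {..<M}" "heap_subtree d n \<subseteq> H"
  shows "(k, n) \<in> {(x, y). x \<in> H \<and> y \<in> H \<and> {x, y} \<in> edges (heap_tree M)}\<^sup>*"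
  using assms
proof (induction d arbitrary: n)
  case (Suc d)
  show ?case
  proof (cases "k = n")
    case False
    then obtain i where i: "i \<in> {1, 2, 3}" "k \<in> heap_subtree d (3 * n + i)"
      using Suc.prems(1) unfolding heap_subtree.simps by blast
    then have sub: "heap_subtree d (3 * n + i) \<subseteq> heap_subtree (Suc d) n" by auto
    have "3 * n + i \<in> heap_subtree (Suc d) n" "n \<in> heap_subtree (Suc d) n"
      using sub root_in_heap_subtree by blast+
    then have "3 * n + i \<in> H" "3 * n + i < M" "n \<in> H" using Suc.prems(2,3) by blast+
    moreover have "{3 * n + i, n} \<in> edges (heap_tree M)"
      using i \<open>3 * n + i < M\<close> unfolding heap_tree_def
      by (auto intro!: exI[of _ "3 * n + i"])
    ultimately have "(3 * n + i, n) \<in> {(x, y). x \<in> H \<and> y \<in> H \<and> {x, y} \<in> edges (heap_tree M)}"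
      by auto
    moreover have "(k, 3 * n + i) \<in> {(x, y). x \<in> H \<and> y \<in> H \<and> {x, y} \<in> edges (heap_tree M)}\<^sup>*"
      using Suc.IH[OF i(2)] sub Suc.prems by blast
    ultimately show ?thesis by (rule rtrancl_into_rtrancl[rotated])
  qed simp
qed simp

text \<open>Each level of the tree gains one vertex: the bag in the middle of the three given by the
  induction hypothesis also meets the connected set formed by the root and the two outer
  subtrees.\<close>

lemma heap_subtree_wide_bag:
  assumes Bs: "path_decomposition (heap_tree M) Bs" and "heap_subtree d n \<subseteq> {..<M}"
  shows "\<exists>i<length Bs. d < card (Bs ! i \<inter> heap_subtree d n)"
  using assms(2)
proof (induction d arbitrary: n)
  case 0
  then have "n \<in> \<Union> (set Bs)" using Bs by (auto simp: path_decomposition_def heap_tree_def)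
  then obtain i where "i < length Bs" "n \<in> Bs ! i" by (metis UnionE in_set_conv_nth)
  then show ?case by auto
next
  case (Suc d)
  let ?D = "\<lambda>a. heap_subtree d (3 * n + a)"
  have "\<exists>i<length Bs. d < card (Bs ! i \<inter> ?D a)" if "a \<in> {1, 2, 3}" for a
    using Suc that by (intro Suc.IH) auto
  then obtain f where f: "\<And>a. a \<in> {1, 2, 3} \<Longrightarrow> f a < length Bs \<and> d < card (Bs ! f a \<inter> ?D a)"
    by metis
  \<comment> \<open>Sorting the three bag positions, possibly with ties, makes \<open>b\<close> the
    child in the middle.\<close>
  have "f 1 \<le> f 2 \<and> f 2 \<le> f 3 \<or> f 1 \<le> f 3 \<and> f 3 \<le> f 2 \<or> f 2 \<le> f 1 \<and> f 1 \<le> f 3 \<or>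
    f 2 \<le> f 3 \<and> f 3 \<le> f 1 \<or> f 3 \<le> f 1 \<and> f 1 \<le> f 2 \<or> f 3 \<le> f 2 \<and> f 2 \<le> f 1"
    by linarith
  then obtain a b c where mem: "a \<in> {1, 2, 3}" "b \<in> {1, 2, 3}" "c \<in> {1, 2, 3}"
    and abc: "a \<noteq> b" "b \<noteq> c" "f a \<le> f b" "f b \<le> f c"
    by (elim disjE conjE) (rule that; (assumption | simp))+
  define H where "H = insert n (?D a \<union> ?D c)"
  let ?r = "{(x, y). x \<in> H \<and> y \<in> H \<and> {x, y} \<in> edges (heap_tree M)}"
  have sub: "?D x \<subseteq> heap_subtree (Suc d) n" if "x \<in> {1, 2, 3}" for x using that by auto
  have "Bs ! f a \<inter> ?D a \<noteq> {}" "Bs ! f c \<inter> ?D c \<noteq> {}"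
    using f mem by (metis card.empty less_nat_zero_code)+
  then obtain u v where u: "u \<in> Bs ! f a" "u \<in> ?D a" and v: "v \<in> Bs ! f c" "v \<in> ?D c" by blast
  have to_root: "(x, n) \<in> ?r\<^sup>*" if "x \<in> ?D y" "y \<in> {a, c}" for x y
  proof -
    have "y \<in> {1, 2, 3}" using that(2) mem by blast
    then have M: "?D y \<subseteq> {..<M}" using Suc.prems sub by blast
    then have "3 * n + y < M" using root_in_heap_subtree by blast
    then have "{3 * n + y, n} \<in> edges (heap_tree M)"
      using \<open>y \<in> {1, 2, 3}\<close> unfolding heap_tree_def
      by (auto intro!: exI[of _ "3 * n + y"])
    then have "(3 * n + y, n) \<in> ?r" using that by (auto simp: H_def)
    moreover have "(x, 3 * n + y) \<in> ?r\<^sup>*"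
      by (rule heap_subtree_connected[OF that(1) M]) (use that in \<open>auto simp: H_def\<close>)
    ultimately show ?thesis by (rule rtrancl_into_rtrancl[rotated])
  qed
  have "sym (?r\<^sup>*)" by (rule sym_rtrancl) (auto simp: sym_def insert_commute)
  then have "(n, v) \<in> ?r\<^sup>*" by (rule symD) (rule to_root[OF v(2)], simp)
  then have "(u, v) \<in> ?r\<^sup>*" by (rule rtrancl_trans[rotated]) (rule to_root[OF u(2)], simp)
  then have "Bs ! f b \<inter> H \<noteq> {}"
    by (rule path_decomposition_hits[OF Bs]) (use abc f mem u v in \<open>auto simp: H_def\<close>)
  then obtain x where x: "x \<in> Bs ! f b" "x \<in> H" by blast
  \<comment> \<open>\<open>x\<close> is the additional vertex: sibling subtrees are disjoint, and
    \<open>n\<close> is smaller than every vertex of \<open>?D b\<close>.\<close>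
  have "x \<notin> ?D b"
    using x(2) heap_subtree_disjoint[of a b d n] heap_subtree_disjoint[of c b d n] mem abc
      heap_subtree_ge[of x d "3 * n + b"] by (auto simp: H_def disjoint_iff)
  moreover have "x \<in> heap_subtree (Suc d) n"
    using x(2) sub[OF mem(1)] sub[OF mem(3)] by (auto simp: H_def)
  ultimately have "insert x (Bs ! f b \<inter> ?D b) \<subseteq> Bs ! f b \<inter> heap_subtree (Suc d) n"
    using x sub[OF mem(2)] by auto
  then have "card (insert x (Bs ! f b \<inter> ?D b)) \<le> card (Bs ! f b \<inter> heap_subtree (Suc d) n)"
    by (intro card_mono) (simp_all del: heap_subtree.simps)
  then have "Suc (card (Bs ! f b \<inter> ?D b)) \<le> card (Bs ! f b \<inter> heap_subtree (Suc d) n)"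
    using \<open>x \<notin> ?D b\<close> by simp
  moreover have "d < card (Bs ! f b \<inter> ?D b)" "f b < length Bs" using f[OF mem(2)] by auto
  ultimately show ?case by (meson less_le_trans Suc_mono)
qed

lemma pathwidth_heap_tree_unbounded: "\<exists>M>0. d \<le> pathwidth (heap_tree M)"
proof -
  obtain M where M: "heap_subtree d 0 \<subseteq> {..<M}"
    using finite_heap_subtree by (metis finite_nat_set_iff_bounded lessThan_iff subsetI)
  have "d \<le> decomposition_width Bs" if Bs: "path_decomposition (heap_tree M) Bs" for Bs
  proof -
    obtain i where i: "i < length Bs" "d < card (Bs ! i \<inter> heap_subtree d 0)"
      using heap_subtree_wide_bag[OF Bs M] by blast
    have "Bs ! i \<subseteq> {..<M}" using Bs i by (auto simp: path_decomposition_def heap_tree_def)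
    then have "card (Bs ! i \<inter> heap_subtree d 0) \<le> card (Bs ! i)"
      by (intro card_mono) (auto intro: finite_subset)
    also have "card (Bs ! i) \<le> Max (card ` set Bs)" using i by simp
    finally show ?thesis using i by (simp add: decomposition_width_def)
  qed
  moreover have "0 < M" using M root_in_heap_subtree[of 0 d] by blast
  moreover have "simple_graph (heap_tree M)"
    using tree_heap_tree[OF \<open>0 < M\<close>] by (simp add: tree_def forest_def)
  ultimately show ?thesis by (metis pathwidth_attained)
qed

section \<open>Plays on forests\<close>

text \<open>For nonempty cables, \<open>card X \<noteq> 1\<close> is the form in which having at
  least two vertices is expressed throughout.\<close>

lemma card_neq_1_obtain:
  assumes "card X \<noteq> 1" "x \<in> X"
  obtains x' where "x' \<in> X" "x' \<noteq> x"
  using assms by (metis insertI1 is_singletonI' is_singleton_altdef empty_iff)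

lemma edge_obtain:
  assumes "simple_graph G" "e \<in> edges G" "v \<in> e"
  obtains z where "e = {v, z}" "z \<noteq> v"
proof -
  obtain x y where "e = {x, y}" "x \<noteq> y"
    using card_edge[OF assms(1,2)] by (auto simp: card_2_iff)
  then show thesis using that[of x] that[of y] assms(3) by (auto simp: insert_commute)
qed

section \<open>Blocks and cliques without short cycles\<close>

lemma forest_no_triangle:
  assumes "forest G" "{x, y} \<in> edges G" "{y, z} \<in> edges G" "{x, z} \<in> edges G"
  shows False
proof -
  have "x \<noteq> y" "y \<noteq> z" "x \<noteq> z"
    using assms edge_neq unfolding forest_def by metis+
  then have "is_cycle G [x, y, z]"
    using assms by (auto simp: is_cycle_def less_Suc_eq insert_commute)
  then show False using assms(1) by (auto simp: forest_def)
qed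

lemma forest_common_neighbour_unique:
  assumes "forest G" "x \<noteq> x'" and E: "{x, y} \<in> edges G" "{x', y} \<in> edges G"
    "{x, z} \<in> edges G" "{x', z} \<in> edges G"
  shows "y = z"
proof (rule ccontr)
  assume "y \<noteq> z"
  have "x \<noteq> y" "x' \<noteq> y" "x \<noteq> z" "x' \<noteq> z"
    using assms edge_neq unfolding forest_def by metis+
  then have "is_cycle G [x, y, x', z]"
    using \<open>y \<noteq> z\<close> assms by (auto simp: is_cycle_def less_Suc_eq insert_commute)
  then show False using assms(1) by (auto simp: forest_def)
qed

lemma block_edges_commute: "block_edges X Y = block_edges Y X"
  by (auto simp: block_edges_def insert_commute)

text \<open>Two vertices on each side would span a 4-cycle, so every block in a forest is a
  star.\<close>

lemma forest_block_singleton: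
  assumes "forest G" "block_edges X Y \<subseteq> edges G" "card X \<noteq> 1" "x \<in> X" "z \<in> Y"
  shows "Y = {z}"
proof -
  obtain x' where x': "x' \<in> X" "x' \<noteq> x" using card_neq_1_obtain assms(3,4) by metis
  have "y = z" if "y \<in> Y" for y
    by (rule forest_common_neighbour_unique[OF assms(1) x'(2)])
      (use assms(2,4,5) x'(1) that in \<open>auto simp: block_edges_def\<close>)
  then show ?thesis using assms(5) by blast
qed

text \<open>A third vertex would give a triangle, so a clique move in a forest places a single
  edge.\<close>

lemma forest_clique_pair:
  assumes "forest G" "clique_edges X \<subseteq> edges G" "x \<in> X" "y \<in> X" "x \<noteq> y"
  shows "X = {x, y}"
proof -
  have "v = x \<or> v = y" if "v \<in> X" for v
  proof (rule ccontr)
    assume "\<not> (v = x \<or> v = y)"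
    then have "{x, y} \<in> clique_edges X" "{y, v} \<in> clique_edges X" "{x, v} \<in> clique_edges X"
      using assms(3-5) that by (auto simp: clique_edges_def)
    then show False using forest_no_triangle[OF assms(1), of x y v] assms(2) by auto
  qed
  then show ?thesis using assms(3,4) by auto
qed

text \<open>\<open>constructs\<close> relative to an arbitrary configuration, for inductions along
  the remainder of a play.\<close>

definition completes :: "'a ugraph \<Rightarrow> 'a config \<Rightarrow> 'a move list \<Rightarrow> bool" where
  "completes G c ms \<longleftrightarrow> legal_play G c ms \<and>
     foldl make_move c ms = \<lparr>born = verts G, live = {}, placed = edges G\<rparr>"

lemma completes_Cons:
  "completes G c (m # ms) \<longleftrightarrow> legal_move G c m \<and> completes G (make_move c m) ms"
  by (auto simp: completes_def)

section \<open>Invariants of plays on a forest\<close>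

locale forest_config =
  fixes G :: "'a ugraph" and c :: "'a config"
  assumes forest: "forest G"
    and live_nonempty: "X \<in> live c \<Longrightarrow> X \<noteq> {}"
    and live_disjoint: "X \<in> live c \<Longrightarrow> Y \<in> live c \<Longrightarrow> v \<in> X \<Longrightarrow> v \<in> Y \<Longrightarrow> X = Y"
    and live_born: "X \<in> live c \<Longrightarrow> X \<subseteq> born c"
    and born_verts: "born c \<subseteq> verts G"
    and placed_edges: "placed c \<subseteq> edges G"
    and placed_born: "e \<in> placed c \<Longrightarrow> e \<subseteq> born c"
begin

lemma simple: "simple_graph G"
  using forest by (simp add: forest_def)

lemma finite_live [simp]: "finite (live c)"
proof -
  have "live c \<subseteq> Pow (verts G)" using live_born born_verts by blast
  then show ?thesis using simple by (auto simp: simple_graph_def intro: finite_subset)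
qed

lemma fold_card:
  assumes "X \<in> live c" "Y \<in> live c" "X \<noteq> Y"
  shows "card (X \<union> Y) \<noteq> 1"
proof
  assume "card (X \<union> Y) = 1"
  then obtain w where "X \<union> Y = {w}" by (auto simp: card_1_singleton_iff)
  then have "X = {w}" "Y = {w}" using live_nonempty[OF assms(1)] live_nonempty[OF assms(2)] by auto
  then show False using assms by simp
qed

lemma forest_config_place:
  assumes "D \<subseteq> edges G" "\<Union> D \<subseteq> born c"
  shows "forest_config G (c\<lparr>placed := placed c \<union> D\<rparr>)"
proof unfold_locales
  show "X = Y" if "X \<in> live (c\<lparr>placed := placed c \<union> D\<rparr>)" "Y \<in> live (c\<lparr>placed := placed c \<union> D\<rparr>)"
    "v \<in> X" "v \<in> Y" for X Y v
    by (rule live_disjoint[of X Y v]) (use that in simp_all)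
  show "e \<subseteq> born (c\<lparr>placed := placed c \<union> D\<rparr>)" if "e \<in> placed (c\<lparr>placed := placed c \<union> D\<rparr>)" for e
    using that assms(2) placed_born[of e] by auto
qed (use assms(1) placed_edges born_verts in \<open>auto simp: forest dest: live_nonempty live_born\<close>)

lemma forest_config_make_move:
  assumes "legal_move G c m"
  shows "forest_config G (make_move c m)"
proof (cases m)
  case (BirthMove S)
  then have S: "S \<noteq> {}" "S \<subseteq> verts G - born c" using assms by auto
  show ?thesis unfolding BirthMove make_move.simps
  proof unfold_locales
    show "X = Y" if "X \<in> live (c\<lparr>born := born c \<union> S, live := insert S (live c)\<rparr>)"
      "Y \<in> live (c\<lparr>born := born c \<union> S, live := insert S (live c)\<rparr>)" "v \<in> X" "v \<in> Y" for X Y v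
    proof -
      have "X \<in> insert S (live c)" "Y \<in> insert S (live c)" using that by auto
      then show ?thesis using that(3,4) S live_born live_disjoint by blast
    qed
  qed (use S placed_edges placed_born in \<open>auto simp: forest
      dest: live_nonempty live_born[THEN subsetD] born_verts[THEN subsetD]\<close>)
next
  case (FoldMove P Q)
  then have PQ: "P \<in> live c" "Q \<in> live c" using assms by auto
  show ?thesis unfolding FoldMove make_move.simps
  proof unfold_locales
    show "X = Y" if "X \<in> live (c\<lparr>live := insert (P \<union> Q) (live c - {P, Q})\<rparr>)"
      "Y \<in> live (c\<lparr>live := insert (P \<union> Q) (live c - {P, Q})\<rparr>)" "v \<in> X" "v \<in> Y" for X Y v
    proof -
      have "X \<in> insert (P \<union> Q) (live c - {P, Q})" "Y \<in> insert (P \<union> Q) (live c - {P, Q})"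
        using that by auto
      then show ?thesis using that(3,4) PQ live_disjoint by blast
    qed
  qed (use PQ placed_edges placed_born in \<open>auto simp: forest
      dest: live_nonempty live_born[THEN subsetD] born_verts[THEN subsetD]\<close>)
next
  case (BlockMove X Y)
  then have "X \<subseteq> born c" "Y \<subseteq> born c" "block_edges X Y \<subseteq> edges G" using assms live_born by auto
  moreover from this have "\<Union> (block_edges X Y) \<subseteq> born c" by (auto simp: block_edges_def)
  ultimately show ?thesis using forest_config_place BlockMove by simp
next
  case (CliqueMove X)
  then have "X \<subseteq> born c" "clique_edges X \<subseteq> edges G" using assms live_born by auto
  moreover from this have "\<Union> (clique_edges X) \<subseteq> born c" by (auto simp: clique_edges_def)
  ultimately show ?thesis using forest_config_place CliqueMove by simp
next
  case (CloseMove Z)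
  show ?thesis unfolding CloseMove make_move.simps
  proof unfold_locales
    show "X = Y" if "X \<in> live (c\<lparr>live := live c - {Z}\<rparr>)" "Y \<in> live (c\<lparr>live := live c - {Z}\<rparr>)"
      "v \<in> X" "v \<in> Y" for X Y v
      by (rule live_disjoint[of X Y v]) (use that in simp_all)
  qed (use placed_edges born_verts placed_born in \<open>auto simp: forest dest: live_nonempty live_born\<close>)
qed

end

text \<open>Cables never split, so the later move that places \<open>{x, z}\<close> acts on a cable
  containing all of \<open>X\<close>. If it is a clique move, this cable is a pair; if it is a block
  move, the opposite cable is \<open>{z}\<close>, which must have been a singleton ever since
  \<open>z\<close> was born.\<close>

lemma unplaced_edge_of_multicable:
  assumes "forest_config G c" "completes G c ms" "X \<in> live c" "card X \<noteq> 1" "x \<in> X"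
    "{x, z} \<in> edges G" "{x, z} \<notin> placed c"
  shows "X = {x, z} \<or> (\<forall>y\<in>X. {y, z} \<in> edges G) \<and> (z \<in> born c \<longrightarrow> {z} \<in> live c)"
  using assms
proof (induction ms arbitrary: c X)
  case Nil
  then show ?case by (simp add: completes_def)
next
  case (Cons m ms)
  interpret forest_config G c by fact
  have legal: "legal_move G c m" and compl: "completes G (make_move c m) ms"
    using Cons.prems(2) by (auto simp: completes_Cons)
  note IH = Cons.IH[OF forest_config_make_move[OF legal] compl]
  show ?case
  proof (cases m)
    case (BirthMove S)
    then show ?thesis using IH[of X] Cons.prems legal by auto
  next
    case (FoldMove P Q)
    then have PQ: "P \<in> live c" "Q \<in> live c" "P \<noteq> Q" using legal by auto
    \<comment> \<open>A fold never produces a singleton, so if \<open>{z}\<close> is live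
      afterwards, it was live before.\<close>
    have ns: "{z} \<noteq> P \<union> Q" using fold_card[OF PQ] by (metis is_singletonI is_singleton_altdef)
    show ?thesis
    proof (cases "X \<in> {P, Q}")
      case True
      then have "P \<union> Q = {x, z} \<or>
        (\<forall>y\<in>P \<union> Q. {y, z} \<in> edges G) \<and> (z \<in> born c \<longrightarrow> {z} \<in> live c - {P, Q})"
        using IH[of "P \<union> Q"] fold_card[OF PQ] Cons.prems ns FoldMove by auto
      moreover have "X = {x, z}" if "P \<union> Q = {x, z}"
      proof -
        obtain x' where "x' \<in> X" "x' \<noteq> x" using card_neq_1_obtain Cons.prems(4,5) by metis
        then show ?thesis using True that Cons.prems(5) by auto
      qed
      ultimately show ?thesis using True by auto
    next
      case False
      then show ?thesis using IH[of X] Cons.prems ns FoldMove by auto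
    qed
  next
    case (BlockMove P Q)
    then have PQ: "P \<in> live c" "Q \<in> live c" "block_edges P Q \<subseteq> edges G" using legal by auto
    have hit: ?thesis if "x \<in> P'" "z \<in> Q'" "P' \<in> live c" "Q' \<in> live c" "block_edges P' Q' \<subseteq> edges G"
      for P' Q'
    proof -
      have "P' = X" using live_disjoint Cons.prems that by blast
      then have "Q' = {z}" using forest_block_singleton[OF forest] Cons.prems(4,5) that by metis
      then show ?thesis using that \<open>P' = X\<close> by (auto simp: block_edges_def)
    qed
    show ?thesis
    proof (cases "{x, z} \<in> block_edges P Q")
      case True
      then have "x \<in> P \<and> z \<in> Q \<or> x \<in> Q \<and> z \<in> P" by (auto simp: block_edges_def doubleton_eq_iff)
      then show ?thesis using hit[of P Q] hit[of Q P] PQ by (auto simp: block_edges_commute)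
    next
      case False
      then show ?thesis using IH[of X] Cons.prems BlockMove by auto
    qed
  next
    case (CliqueMove P)
    show ?thesis
    proof (cases "{x, z} \<in> clique_edges P")
      case True
      then have "x \<in> P" "z \<in> P" "x \<noteq> z" by (auto simp: clique_edges_def doubleton_eq_iff)
      moreover have "P = X" using live_disjoint Cons.prems \<open>x \<in> P\<close> CliqueMove legal by auto
      ultimately show ?thesis using forest_clique_pair[OF forest] CliqueMove legal by auto
    next
      case False
      then show ?thesis using IH[of X] Cons.prems CliqueMove by auto
    qed
  next
    case (CloseMove P)
    \<comment> \<open>The closed cable has no unplaced edges, whereas \<open>X\<close> still has
      \<open>{x, z}\<close>.\<close>
    then have "X \<noteq> P" using legal Cons.prems by auto
    then show ?thesis using IH[of X] Cons.prems CloseMove by auto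
  qed
qed

section \<open>The path decomposition of a play\<close>

text \<open>The interval condition of \<open>path_decomposition\<close> on its own, since the bags
  built during a play do not cover the graph yet.\<close>

definition contiguous :: "'a set list \<Rightarrow> bool" where
  "contiguous Bs \<longleftrightarrow>
     (\<forall>i j k. i \<le> j \<and> j \<le> k \<and> k < length Bs \<longrightarrow> Bs ! i \<inter> Bs ! k \<subseteq> Bs ! j)"

lemma contiguous_snoc:
  assumes "contiguous Bs" "Bs \<noteq> []" "B \<inter> \<Union> (set Bs) \<subseteq> last Bs"
  shows "contiguous (Bs @ [B])"
  unfolding contiguous_def
proof (intro allI impI)
  fix i j k assume ijk: "i \<le> j \<and> j \<le> k \<and> k < length (Bs @ [B])"
  show "(Bs @ [B]) ! i \<inter> (Bs @ [B]) ! k \<subseteq> (Bs @ [B]) ! j"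
  proof (cases "j < length Bs")
    case False
    then show ?thesis using ijk by (auto simp: nth_append)
  next
    case j: True
    show ?thesis
    proof (cases "k < length Bs")
      case True
      then show ?thesis using assms(1) ijk j unfolding contiguous_def by (auto simp: nth_append)
    next
      case False
      have "Bs ! i \<in> set Bs" using ijk j by auto
      then have "Bs ! i \<inter> B \<subseteq> Bs ! i \<inter> Bs ! (length Bs - 1)"
        using assms(2,3) by (auto simp: last_conv_nth)
      also have "\<dots> \<subseteq> Bs ! j"
        by (rule assms(1)[unfolded contiguous_def, rule_format]) (use ijk j in linarith)
      finally show ?thesis using False ijk j by (auto simp: nth_append)
    qed
  qed
qed

text \<open>The bags \<open>insert y R\<close> are appended one by one; each keeps \<open>R\<close>
  available for the next, and each fresh \<open>y\<close> occurs in just one of them.\<close>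

lemma contiguous_attach:
  assumes "finite Y" "contiguous Bs" "Bs \<noteq> []" "R \<subseteq> last Bs" "Y \<inter> \<Union> (set Bs) = {}"
  shows "\<exists>Bs'. contiguous Bs' \<and> Bs' \<noteq> [] \<and> R \<subseteq> last Bs' \<and>
    set Bs' = set Bs \<union> (\<lambda>y. insert y R) ` Y"
  using assms
proof (induction Y rule: finite_induct)
  case empty
  then show ?case by auto
next
  case (insert y Y)
  then obtain Bs' where Bs': "contiguous Bs'" "Bs' \<noteq> []" "R \<subseteq> last Bs'"
    "set Bs' = set Bs \<union> (\<lambda>y. insert y R) ` Y" by auto
  have "R \<subseteq> \<Union> (set Bs)" using insert.prems(2,3) last_in_set by blast
  then have "y \<notin> \<Union> (set Bs')" using Bs'(4) insert.hyps insert.prems(4) by auto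
  then have "contiguous (Bs' @ [insert y R])"
    using Bs' by (intro contiguous_snoc) auto
  then show ?case using Bs' by (intro exI[of _ "Bs' @ [insert y R]"]) auto
qed

section \<open>Representatives of live cables\<close>

definition touched_cables :: "'a set set \<Rightarrow> 'a set set \<Rightarrow> 'a set set" where
  "touched_cables C L = {X \<in> L. X \<inter> \<Union> C \<noteq> {}}"

text \<open>The set \<open>C\<close> of edges regarded as placed; a common neighbour represents a cable only as long
  as one of its edges to the cable is missing.\<close>

definition cable_rep :: "'a ugraph \<Rightarrow> 'a set set \<Rightarrow> 'a set \<Rightarrow> 'a set" where
  "cable_rep G C X = (if card X = 1 then X
     else {z. (\<forall>x\<in>X. {x, z} \<in> edges G) \<and> (\<exists>x\<in>X. {x, z} \<notin> C)})"

text \<open>The vertices that the last bag has to contain at the current moment of the play.\<close>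

definition anchor :: "'a ugraph \<Rightarrow> 'a set set \<Rightarrow> 'a set set \<Rightarrow> 'a set" where
  "anchor G C L = \<Union> (cable_rep G C ` touched_cables C L)"

lemma mem_anchor:
  "z \<in> anchor G C L \<longleftrightarrow> (\<exists>X\<in>L. X \<inter> \<Union> C \<noteq> {} \<and> z \<in> cable_rep G C X)"
  by (auto simp: anchor_def touched_cables_def)

lemma anchorI: "X \<in> L \<Longrightarrow> X \<inter> \<Union> C \<noteq> {} \<Longrightarrow> z \<in> cable_rep G C X \<Longrightarrow> z \<in> anchor G C L"
  unfolding mem_anchor by blast

lemma cable_rep_singleton [simp]: "cable_rep G C {v} = {v}"
  by (simp add: cable_rep_def)

lemma mem_cable_rep_multi:
  "card X \<noteq> 1 \<Longrightarrow> z \<in> cable_rep G C X \<longleftrightarrow>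
     (\<forall>x\<in>X. {x, z} \<in> edges G) \<and> (\<exists>x\<in>X. {x, z} \<notin> C)"
  by (simp add: cable_rep_def)

text \<open>Two common neighbours of two distinct vertices would form a 4-cycle with them.\<close>

lemma cable_rep_card:
  assumes "forest G" "X \<noteq> {}"
  shows "finite (cable_rep G C X)" "card (cable_rep G C X) \<le> 1"
proof -
  have "\<exists>z. cable_rep G C X \<subseteq> {z}"
  proof (cases "card X = 1")
    case True
    then show ?thesis by (auto simp: card_1_singleton_iff)
  next
    case False
    then obtain x x' where "x \<in> X" "x' \<in> X" "x' \<noteq> x"
      using card_neq_1_obtain[OF False] assms(2) by (metis all_not_in_conv)
    then have "z = z'" if "z \<in> cable_rep G C X" "z' \<in> cable_rep G C X" for z z'
      using forest_common_neighbour_unique[OF assms(1), of x x' z z'] that False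
      by (auto simp: mem_cable_rep_multi)
    then show ?thesis by blast
  qed
  then obtain z where "cable_rep G C X \<subseteq> {z}" ..
  then show "finite (cable_rep G C X)" "card (cable_rep G C X) \<le> 1"
    using finite_subset card_mono[of "{z}" "cable_rep G C X"] by auto
qed

lemma cable_rep_Un_disjoint:
  assumes "X \<inter> \<Union> D = {}"
  shows "cable_rep G (C \<union> D) X = cable_rep G C X"
proof -
  have "{x, z} \<notin> D" if "x \<in> X" for x z using assms that by blast
  then show ?thesis unfolding cable_rep_def by auto
qed

lemma (in forest_config) card_anchor:
  "finite (anchor G C (live c))" "card (anchor G C (live c)) \<le> card (touched_cables C (live c))"
proof -
  have fin: "finite (touched_cables C (live c))" by (simp add: touched_cables_def)
  have rep: "finite (cable_rep G C X)" "card (cable_rep G C X) \<le> 1"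
    if "X \<in> touched_cables C (live c)" for X
    using cable_rep_card[OF forest] live_nonempty that by (auto simp: touched_cables_def)
  then show "finite (anchor G C (live c))" using fin by (auto simp: anchor_def)
  have "card (anchor G C (live c)) \<le> (\<Sum>X\<in>touched_cables C (live c). card (cable_rep G C X))"
    unfolding anchor_def by (rule card_UN_le[OF fin])
  also have "\<dots> \<le> card (touched_cables C (live c))"
    using sum_bounded_above[of "touched_cables C (live c)" "\<lambda>X. card (cable_rep G C X)" 1] rep(2) by simp
  finally show "card (anchor G C (live c)) \<le> card (touched_cables C (live c))" .
qed

text \<open>Folding the two ends of an unplaced edge into one cable puts this edge into \<open>C\<close> at once, before
  the clique move that places it: afterwards no representative could keep the two ends in a bag.\<close>

locale sweep = forest_config +
  fixes b :: nat and C :: "'a set set" and Bs :: "'a set list"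
  assumes placed_C: "placed c \<subseteq> C" and C_edges: "C \<subseteq> edges G"
    and C_live: "C - placed c \<subseteq> live c"
    and bags_nonempty: "Bs \<noteq> []" and bags_contiguous: "contiguous Bs"
    and bag_card: "B \<in> set Bs \<Longrightarrow> card B \<le> b" and bags_verts: "\<Union> (set Bs) \<subseteq> verts G"
    and C_bag: "e \<in> C \<Longrightarrow> \<exists>B\<in>set Bs. e \<subseteq> B"
    and anchor_last: "anchor G C (live c) \<subseteq> last Bs"
    and bags_sub: "\<Union> (set Bs) \<subseteq> anchor G C (live c) \<union> \<Union> C"
    and retired: "v \<in> \<Union> C \<Longrightarrow> {v} \<notin> live c \<Longrightarrow> e \<in> edges G \<Longrightarrow> v \<in> e \<Longrightarrow> \<exists>B\<in>set Bs. e \<subseteq> B"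
    and touched_card: "card (touched_cables C (live c)) < b"
begin

lemma C_born: "\<Union> C \<subseteq> born c"
  using C_live placed_born live_born by blast

text \<open>A touched vertex represents its own cable, and for an untouched one
  \<open>bags_sub\<close> leaves only the anchor. By \<open>anchor_last\<close> such a vertex is in
  the last bag, so the next bag may contain it without leaving a gap.\<close>

lemma singleton_rep:
  assumes "{u} \<in> live c" "u \<in> \<Union> C \<or> u \<in> \<Union> (set Bs)"
  shows "u \<in> anchor G C (live c)"
proof (cases "u \<in> \<Union> C")
  case True
  then show ?thesis using assms(1) by (auto simp: mem_anchor intro!: bexI[of _ "{u}"])
next
  case False
  then show ?thesis using assms bags_sub by blast
qed

text \<open>By \<open>bags_sub\<close> an untouched vertex enters a bag only as a representative.
  Representing a singleton cable, it would be that cable; representing a larger one, it would, being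
  born, form a live cable alone. Either way it could not share the cable \<open>Y\<close>.\<close>

lemma untouched_multi_fresh:
  assumes "completes G c ms" "Y \<in> live c" "card Y \<noteq> 1" "y \<in> Y" "y \<notin> \<Union> C"
  shows "y \<notin> \<Union> (set Bs)"
proof
  assume "y \<in> \<Union> (set Bs)"
  then have "y \<in> anchor G C (live c)" using bags_sub assms(5) by blast
  then obtain X where X: "X \<in> live c" "X \<inter> \<Union> C \<noteq> {}" "y \<in> cable_rep G C X"
    by (auto simp: mem_anchor)
  show False
  proof (cases "card X = 1")
    case True
    then have "X = {y}" using X(3) by (auto simp: card_1_singleton_iff)
    then show False using live_disjoint[OF X(1) assms(2), of y] assms by auto
  next
    case False
    then obtain x where x: "x \<in> X" "{x, y} \<notin> C" and adj: "\<forall>x\<in>X. {x, y} \<in> edges G"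
      using X(3) by (auto simp: mem_cable_rep_multi)
    have "y \<notin> X" using adj edge_neq[OF simple] by blast
    then have "{y} \<in> live c"
      using unplaced_edge_of_multicable[OF forest_config_axioms assms(1) X(1) False x(1), of y]
        x adj placed_C live_born[OF assms(2)] assms(4) by blast
    then show False using live_disjoint[OF _ assms(2), of "{y}" y] assms by auto
  qed
qed

text \<open>What the moves have in common; \<open>S\<close> consists of the added bags. The
  condition \<open>retired\<close> is left to check only for vertices that have just been touched or
  have just left a singleton cable, as earlier bags are kept.\<close>

lemma sweep_extend:
  assumes "forest_config G c'" "placed c' \<subseteq> C'" "C' \<subseteq> edges G" "C' - placed c' \<subseteq> live c'"
    and "contiguous Bs'" "Bs' \<noteq> []" "set Bs' = set Bs \<union> S"
    and S: "\<And>B. B \<in> S \<Longrightarrow> card B \<le> b \<and> B \<subseteq> verts G \<and> B \<subseteq> anchor G C' (live c') \<union> \<Union> C'"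
    and "\<And>e. e \<in> C' - C \<Longrightarrow> \<exists>B\<in>set Bs'. e \<subseteq> B"
    and "anchor G C' (live c') \<subseteq> last Bs'" "\<Union> C \<subseteq> \<Union> C'"
    and "anchor G C (live c) \<subseteq> anchor G C' (live c') \<union> \<Union> C'"
    and ret: "\<And>v e. v \<in> \<Union> C' \<Longrightarrow> {v} \<notin> live c' \<Longrightarrow> v \<notin> \<Union> C \<or> {v} \<in> live c \<Longrightarrow>
      e \<in> edges G \<Longrightarrow> v \<in> e \<Longrightarrow> \<exists>B\<in>set Bs'. e \<subseteq> B"
    and "card (touched_cables C' (live c')) < b"
  shows "sweep G c' b C' Bs'"
proof -
  interpret c': forest_config G c' by fact
  show ?thesis
  proof unfold_locales
    have un: "\<Union> (set Bs') = \<Union> (set Bs) \<union> \<Union> S" using assms(7) by auto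
    have sub: "set Bs \<subseteq> set Bs'" using assms(7) by auto
    have SV: "\<Union> S \<subseteq> verts G" "\<Union> S \<subseteq> anchor G C' (live c') \<union> \<Union> C'" using S by blast+
    show "card B \<le> b" if "B \<in> set Bs'" for B using that assms(7) S[of B] bag_card[of B] by auto
    show "\<Union> (set Bs') \<subseteq> verts G" using un SV(1) bags_verts by auto
    show "\<exists>B\<in>set Bs'. e \<subseteq> B" if "e \<in> C'" for e
      using that assms(9)[of e] C_bag[of e] sub by blast
    show "\<Union> (set Bs') \<subseteq> anchor G C' (live c') \<union> \<Union> C'"
      unfolding un using assms(11,12) SV(2) bags_sub by blast
    show "\<exists>B\<in>set Bs'. e \<subseteq> B" if "v \<in> \<Union> C'" "{v} \<notin> live c'" "e \<in> edges G" "v \<in> e" for v e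
    proof (cases "v \<notin> \<Union> C \<or> {v} \<in> live c")
      case True
      then show ?thesis using ret[of v e] that by simp
    next
      case False
      then show ?thesis using retired[of v e] that sub by blast
    qed
  qed (use assms in auto)
qed

section \<open>The effect of each kind of move\<close>

lemma sweep_birth:
  assumes "legal_move G c (BirthMove S)"
  shows "sweep G (make_move c (BirthMove S)) b C Bs"
proof -
  \<comment> \<open>Edges in \<open>C\<close> have born ends, so the new cable is untouched and
    receives no representative.\<close>
  have S: "S \<inter> \<Union> C = {}" using assms C_born by auto
  then have "touched_cables C (insert S (live c)) = touched_cables C (live c)"
    by (auto simp: touched_cables_def)
  moreover from this have "anchor G C (insert S (live c)) = anchor G C (live c)"
    by (simp add: anchor_def)
  ultimately show ?thesis
    using forest_config_make_move[OF assms] placed_C C_edges C_live bags_contiguous bags_nonempty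
      anchor_last touched_card
    by (intro sweep_extend[where S = "{}"]) auto
qed

text \<open>A closed cable has all its edges in \<open>C\<close>, so no common neighbour represents
  it any more. If it is a touched singleton, its vertex remains in \<open>\<Union> C\<close>. No bag
  is added.\<close>

lemma sweep_close:
  assumes "legal_move G c (CloseMove X)"
  shows "sweep G (make_move c (CloseMove X)) b C Bs"
proof -
  have X: "X \<in> live c" and finished: "\<And>e. e \<in> edges G \<Longrightarrow> e \<inter> X \<noteq> {} \<Longrightarrow> e \<in> placed c"
    using assms by auto
  have sub: "touched_cables C (live c - {X}) \<subseteq> touched_cables C (live c)"
    by (auto simp: touched_cables_def)
  then have anc: "anchor G C (live c - {X}) \<subseteq> anchor G C (live c)" by (auto simp: anchor_def)
  have "v \<in> anchor G C (live c - {X}) \<union> \<Union> C" if v: "v \<in> anchor G C (live c)" for v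
  proof -
    obtain Y where Y: "Y \<in> live c" "Y \<inter> \<Union> C \<noteq> {}" "v \<in> cable_rep G C Y"
      using v by (auto simp: mem_anchor)
    consider "Y \<noteq> X" | "Y = {v}" | "Y = X" "card X \<noteq> 1"
      using Y(3) by (cases "card Y = 1") (auto simp: card_1_singleton_iff)
    then show ?thesis
    proof cases
      case 3
      then obtain x where "x \<in> X" "{x, v} \<notin> C" "{x, v} \<in> edges G"
        using Y(3) by (auto simp: mem_cable_rep_multi)
      then show ?thesis using finished[of "{x, v}"] placed_C by auto
    qed (use Y in \<open>auto simp: mem_anchor\<close>)
  qed
  then have anc': "anchor G C (live c) \<subseteq> anchor G C (live c - {X}) \<union> \<Union> C" by blast
  have "finite (touched_cables C (live c))" by (simp add: touched_cables_def)
  then have "card (touched_cables C (live c - {X})) < b"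
    using card_mono[OF _ sub] touched_card by simp
  moreover have "C - placed c \<subseteq> live c - {X}"
  proof -
    have "e \<noteq> X" if "e \<in> C" "e \<notin> placed c" for e
      using that finished[of e] C_edges live_nonempty[OF X] by blast
    then show ?thesis using C_live by blast
  qed
  moreover have "\<exists>B\<in>set Bs. e \<subseteq> B"
    if "{v} \<notin> live c - {X}" "v \<notin> \<Union> C \<or> {v} \<in> live c" "v \<in> \<Union> C" "e \<in> edges G" "v \<in> e" for v e
    using that finished[of e] placed_C C_bag by blast
  ultimately show ?thesis
    using forest_config_make_move[OF assms] placed_C C_edges bags_contiguous bags_nonempty
      anchor_last anc anc' by (intro sweep_extend[where S = "{}"]) (simp_all, blast)
qed


text \<open>The folded cables are the singletons of the two ends of an edge. One bag with both ends
  and all current representatives covers the edge; for lack of triangles, the merged cable has no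
  representative, and its two vertices have no other missing edges.\<close>

lemma sweep_fold_edge:
  assumes legal: "legal_move G c (FoldMove X Y)" and W: "X \<union> Y \<in> edges G"
    and compl: "completes G (make_move c (FoldMove X Y)) ms" and cost: "card (live c) \<le> b"
  shows "\<exists>C' Bs'. sweep G (make_move c (FoldMove X Y)) b C' Bs'"
proof -
  define c' where "c' = make_move c (FoldMove X Y)"
  define C' where "C' = C \<union> {X \<union> Y}"
  define L0 where "L0 = live c - {X, Y}"
  have XY: "X \<in> live c" "Y \<in> live c" "X \<noteq> Y" using legal by auto
  have c': "live c' = insert (X \<union> Y) L0" "placed c' = placed c" by (auto simp: c'_def L0_def)
  have fc': "forest_config G c'" unfolding c'_def by (rule forest_config_make_move[OF legal])
  obtain x y where xy: "x \<in> X" "y \<in> Y" using live_nonempty XY by (metis all_not_in_conv)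
  have "x \<noteq> y" using live_disjoint[OF XY(1,2)] xy XY(3) by blast
  obtain z where z: "X \<union> Y = {x, z}" using edge_obtain[OF simple W, of x] xy by blast
  moreover have "y \<in> X \<union> Y" using xy by simp
  ultimately have Wxy: "X \<union> Y = {x, y}" using \<open>x \<noteq> y\<close> by auto
  have "y \<notin> X" "x \<notin> Y" using live_disjoint[OF XY(1,2)] xy XY(3) by blast+
  then have X: "X = {x}" and Y: "Y = {y}" using Wxy xy by auto
  have exy: "{x, y} \<in> edges G" using W Wxy by simp
  have disj: "V \<inter> {x, y} = {}" if "V \<in> L0" for V
    using that live_disjoint[of V X x] live_disjoint[of V Y y] XY xy unfolding L0_def by blast
  have rep_W: "cable_rep G C' {x, y} = {}"
  proof -
    have "\<not> ({x, z} \<in> edges G \<and> {y, z} \<in> edges G)" for z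
      using forest_no_triangle[OF forest exy, of z] by blast
    then show ?thesis using \<open>x \<noteq> y\<close> by (auto simp: cable_rep_def)
  qed
  have rep: "cable_rep G C' V = cable_rep G C V" "V \<inter> \<Union> C' = V \<inter> \<Union> C" if "V \<in> L0" for V
    using cable_rep_Un_disjoint[of V "{X \<union> Y}"] disj[OF that] unfolding C'_def Wxy by auto
  have C'_un: "\<Union> C' = \<Union> C \<union> {x, y}" by (auto simp: C'_def Wxy)
  define R where "R = anchor G C (live c)"
  have R': "anchor G C' (live c') \<subseteq> R"
  proof
    fix v assume "v \<in> anchor G C' (live c')"
    then obtain V where V: "V \<in> live c'" "V \<inter> \<Union> C' \<noteq> {}" "v \<in> cable_rep G C' V"
      by (auto simp: mem_anchor)
    then have "V \<in> L0" using rep_W by (auto simp: c' Wxy)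
    then have "V \<in> live c" "V \<inter> \<Union> C \<noteq> {}" "v \<in> cable_rep G C V"
      using V rep[OF \<open>V \<in> L0\<close>] by (simp_all add: L0_def)
    then show "v \<in> R" unfolding R_def by (rule anchorI)
  qed
  have RR': "R \<subseteq> anchor G C' (live c') \<union> {x, y}"
  proof
    fix v assume "v \<in> R"
    then obtain V where V: "V \<in> live c" "V \<inter> \<Union> C \<noteq> {}" "v \<in> cable_rep G C V"
      by (auto simp: R_def mem_anchor)
    show "v \<in> anchor G C' (live c') \<union> {x, y}"
    proof (cases "V \<in> L0")
      case True
      then have "V \<in> live c'" "V \<inter> \<Union> C' \<noteq> {}" "v \<in> cable_rep G C' V"
        using V rep[OF True] by (simp_all add: c')
      then show ?thesis by (blast intro: anchorI)
    next
      case False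
      then show ?thesis using V X Y by (auto simp: L0_def)
    qed
  qed
  let ?S = "touched_cables C (live c)"
  have finS: "finite ?S" by (simp add: touched_cables_def)
  \<comment> \<open>Both ends must fit beside the other representatives. If neither cable is
    touched, both are counted in \<open>card (live c) \<le> b\<close>; otherwise at least one
    touched cable drops out.\<close>
  have S0: "card (?S - {X, Y}) + 1 < b"
  proof (cases "?S \<inter> {X, Y} = {}")
    case True
    then have "insert X (insert Y ?S) \<subseteq> live c" using XY by (auto simp: touched_cables_def)
    then have "card (insert X (insert Y ?S)) \<le> card (live c)" by (rule card_mono[OF finite_live])
    moreover have "card (insert X (insert Y ?S)) = card ?S + 2" using finS True XY(3) by simp
    moreover have "card (?S - {X, Y}) \<le> card ?S" using finS by (simp add: card_mono)
    ultimately show ?thesis using cost by linarith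
  next
    case False
    then have "card (?S - {X, Y}) < card ?S" using finS by (intro psubset_card_mono) auto
    then show ?thesis using touched_card by linarith
  qed
  have fin: "finite (\<Union> (cable_rep G C ` (?S - {X, Y})))"
    by (rule finite_subset[OF _ card_anchor(1)[of C]]) (auto simp: anchor_def)
  have "R \<subseteq> \<Union> (cable_rep G C ` (?S - {X, Y})) \<union> cable_rep G C X \<union> cable_rep G C Y"
    unfolding R_def anchor_def by blast
  then have "R \<union> {x, y} \<subseteq> \<Union> (cable_rep G C ` (?S - {X, Y})) \<union> {x, y}"
    unfolding X Y by auto
  then have "card (R \<union> {x, y}) \<le> card (\<Union> (cable_rep G C ` (?S - {X, Y})) \<union> {x, y})"
    using fin by (intro card_mono) auto
  also have "\<dots> \<le> card (\<Union> (cable_rep G C ` (?S - {X, Y}))) + card {x, y}" by (rule card_Un_le)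
  also have "card (\<Union> (cable_rep G C ` (?S - {X, Y}))) \<le> (\<Sum>V\<in>?S - {X, Y}. card (cable_rep G C V))"
    using finS by (intro card_UN_le) simp
  also have "\<dots> \<le> card (?S - {X, Y})"
  proof -
    have "card (cable_rep G C V) \<le> 1" if "V \<in> ?S - {X, Y}" for V
      using that by (intro cable_rep_card(2)[OF forest live_nonempty]) (auto simp: touched_cables_def)
    then show ?thesis
      using sum_bounded_above[of "?S - {X, Y}" "\<lambda>V. card (cable_rep G C V)" 1] by simp
  qed
  finally have bag: "card (R \<union> {x, y}) \<le> b" using S0 \<open>x \<noteq> y\<close> by simp
  have "touched_cables C' (live c') \<subseteq> insert (X \<union> Y) (?S - {X, Y})"
    using rep(2) by (auto simp: touched_cables_def c' L0_def)
  then have "card (touched_cables C' (live c')) \<le> card (insert (X \<union> Y) (?S - {X, Y}))"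
    using finS by (intro card_mono) auto
  also have "\<dots> \<le> card (?S - {X, Y}) + 1" using finS by (simp add: card_insert_if)
  finally have touched': "card (touched_cables C' (live c')) < b" using S0 by simp
  have RV: "R \<subseteq> \<Union> (set Bs)" "R \<subseteq> last Bs"
    using anchor_last last_in_set[OF bags_nonempty] unfolding R_def by blast+
  have xyR: "v \<in> R" if "v \<in> {x, y}" "v \<in> \<Union> (set Bs)" for v
    using singleton_rep[of v] that XY X Y unfolding R_def by blast
  have "sweep G c' b C' (Bs @ [R \<union> {x, y}])"
  proof (rule sweep_extend[OF fc', where S = "{R \<union> {x, y}}"])
    show "placed c' \<subseteq> C'" using placed_C by (auto simp: c' C'_def)
    show "C' \<subseteq> edges G" using C_edges W by (auto simp: C'_def)
    show "C' - placed c' \<subseteq> live c'"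
    proof
      fix e assume e: "e \<in> C' - placed c'"
      show "e \<in> live c'"
      proof (cases "e = X \<union> Y")
        case False
        then have "e \<in> live c" "card e = 2"
          using e C_live C_edges card_edge[OF simple] by (auto simp: C'_def c')
        then show ?thesis using X Y by (auto simp: c' L0_def)
      qed (simp add: c')
    qed
    show "contiguous (Bs @ [R \<union> {x, y}])"
      by (rule contiguous_snoc[OF bags_contiguous bags_nonempty]) (use xyR RV in blast)
    show "set (Bs @ [R \<union> {x, y}]) = set Bs \<union> {R \<union> {x, y}}" by simp
    have "R \<union> {x, y} \<subseteq> verts G"
      using RV(1) bags_verts edge_subset_verts[OF simple exy] by blast
    then show "card B \<le> b \<and> B \<subseteq> verts G \<and> B \<subseteq> anchor G C' (live c') \<union> \<Union> C'"
      if "B \<in> {R \<union> {x, y}}" for B using that bag RR' C'_un by auto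
    show "\<exists>B\<in>set (Bs @ [R \<union> {x, y}]). e \<subseteq> B" if "e \<in> C' - C" for e
      using that by (auto simp: C'_def Wxy)
    show "anchor G C' (live c') \<subseteq> last (Bs @ [R \<union> {x, y}])" using R' by auto
    show "\<Union> C \<subseteq> \<Union> C'" by (auto simp: C'_un)
    show "anchor G C (live c) \<subseteq> anchor G C' (live c') \<union> \<Union> C'" using RR' by (auto simp: C'_un R_def)
    show "\<exists>B\<in>set (Bs @ [R \<union> {x, y}]). e \<subseteq> B" if v: "v \<in> \<Union> C'" "{v} \<notin> live c'"
      "v \<notin> \<Union> C \<or> {v} \<in> live c" "e \<in> edges G" "v \<in> e" for v e
    proof -
      have vxy: "v \<in> {x, y}" using v X Y by (auto simp: C'_un c' L0_def)
      obtain z where z: "e = {v, z}" using edge_obtain[OF simple v(4,5)] .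
      \<comment> \<open>If \<open>{v, z}\<close> were still missing, \<open>z\<close> would be a
        common neighbour of \<open>x\<close> and \<open>y\<close>, giving a triangle.\<close>
      have "e \<in> C'"
      proof (rule ccontr)
        assume "e \<notin> C'"
        then have "e \<notin> placed c'" using placed_C by (auto simp: c' C'_def)
        then have "{x, y} = {v, z} \<or> (\<forall>u\<in>{x, y}. {u, z} \<in> edges G)"
          using unplaced_edge_of_multicable[OF fc' compl[folded c'_def], of "{x, y}" v z] vxy v(4) z
            c' Wxy \<open>x \<noteq> y\<close> by auto
        moreover have "{x, y} \<noteq> {v, z}" using \<open>e \<notin> C'\<close> z by (auto simp: C'_def Wxy)
        ultimately show False using forest_no_triangle[OF forest exy, of z] by auto
      qed
      then show ?thesis using C_bag by (auto simp: C'_def Wxy)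
    qed
    show "card (touched_cables C' (live c')) < b" by (rule touched')
  qed simp
  then show ?thesis unfolding c'_def by blast
qed

text \<open>All missing edges of the merged cable lead to one common neighbour. A single bag with
  the old representatives and this neighbour covers the missing edges of touched vertices that lose
  their singleton cable.\<close>

lemma sweep_fold_nonedge:
  assumes legal: "legal_move G c (FoldMove X Y)" and W: "X \<union> Y \<notin> edges G"
    and compl: "completes G (make_move c (FoldMove X Y)) ms"
  shows "\<exists>C' Bs'. sweep G (make_move c (FoldMove X Y)) b C' Bs'"
proof -
  define c' where "c' = make_move c (FoldMove X Y)"
  define W where "W = X \<union> Y"
  define L0 where "L0 = live c - {X, Y}"
  have XY: "X \<in> live c" "Y \<in> live c" "X \<noteq> Y" using legal by auto
  have c': "live c' = insert W L0" "placed c' = placed c" "born c' = born c"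
    by (auto simp: c'_def L0_def W_def)
  have fc': "forest_config G c'" unfolding c'_def by (rule forest_config_make_move[OF legal])
  have cardW: "card W \<noteq> 1" using fold_card[OF XY] by (simp add: W_def)
  \<comment> \<open>The alternative that the cable is itself the unplaced edge is excluded because
    \<open>W\<close> is not an edge.\<close>
  have future: "(\<forall>y\<in>W. {y, z} \<in> edges G) \<and> (z \<in> born c \<longrightarrow> {z} \<in> live c)"
    if "x \<in> W" "{x, z} \<in> edges G" "{x, z} \<notin> C" for x z
  proof -
    have "W = {x, z} \<or> (\<forall>y\<in>W. {y, z} \<in> edges G) \<and> (z \<in> born c' \<longrightarrow> {z} \<in> live c')"
      using unplaced_edge_of_multicable[OF fc' compl[folded c'_def], of W x z] that cardW placed_C c'
      by auto
    then have "(\<forall>y\<in>W. {y, z} \<in> edges G) \<and> (z \<in> born c \<longrightarrow> {z} \<in> insert W L0)"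
      using that(2) W c' by (auto simp: W_def)
    moreover have "W \<noteq> {z}" using cardW by auto
    ultimately show ?thesis by (auto simp: L0_def)
  qed
  define Z where "Z = (if W \<inter> \<Union> C = {} then {} else cable_rep G C W)"
  define R where "R = anchor G C (live c)"
  have Z: "(\<forall>y\<in>W. {y, z} \<in> edges G) \<and> (z \<in> born c \<longrightarrow> {z} \<in> live c)" if "z \<in> Z" for z
  proof -
    have "z \<in> cable_rep G C W" using that by (auto simp: Z_def split: if_splits)
    then obtain x where "x \<in> W" "{x, z} \<in> edges G" "{x, z} \<notin> C"
      using mem_cable_rep_multi[OF cardW] by blast
    then show ?thesis by (rule future)
  qed
  have R': "anchor G C (live c') \<subseteq> R \<union> Z"
  proof
    fix v assume "v \<in> anchor G C (live c')"
    then obtain V where V: "V \<in> live c'" "V \<inter> \<Union> C \<noteq> {}" "v \<in> cable_rep G C V"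
      by (auto simp: mem_anchor)
    show "v \<in> R \<union> Z"
    proof (cases "V = W")
      case True
      then show ?thesis using V by (simp add: Z_def)
    next
      case False
      then have "V \<in> live c" using V(1) by (auto simp: c' L0_def)
      then show ?thesis using V(2,3) unfolding R_def by (blast intro: anchorI)
    qed
  qed
  have ZR': "Z \<subseteq> anchor G C (live c')"
  proof
    fix z assume "z \<in> Z"
    then have "W \<inter> \<Union> C \<noteq> {}" "z \<in> cable_rep G C W" by (simp_all add: Z_def split: if_splits)
    then show "z \<in> anchor G C (live c')" by (rule anchorI[rotated]) (simp add: c')
  qed
  have RR': "R \<subseteq> anchor G C (live c') \<union> \<Union> C"
  proof
    fix v assume "v \<in> R"
    then obtain V where V: "V \<in> live c" "V \<inter> \<Union> C \<noteq> {}" "v \<in> cable_rep G C V"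
      by (auto simp: R_def mem_anchor)
    consider "V \<in> L0" | "V = {v}" | "V \<subseteq> W" "card V \<noteq> 1"
      using V(1,3) by (cases "card V = 1") (auto simp: card_1_singleton_iff L0_def W_def)
    then show "v \<in> anchor G C (live c') \<union> \<Union> C"
    proof cases
      case 3
      then obtain x where x: "x \<in> V" "{x, v} \<in> edges G" "{x, v} \<notin> C"
        using V(3) by (auto simp: mem_cable_rep_multi)
      then have "v \<in> cable_rep G C W" using future[of x v] 3 cardW
        by (auto simp: mem_cable_rep_multi)
      moreover have "W \<inter> \<Union> C \<noteq> {}" using V(2) 3 by blast
      ultimately show ?thesis by (auto simp: mem_anchor c')
    qed (use V in \<open>auto simp: mem_anchor c'\<close>)
  qed
  let ?S = "touched_cables C (live c)"
  have finS: "finite ?S" by (simp add: touched_cables_def)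
  \<comment> \<open>If the merged cable is touched, it replaces at least one touched cable.\<close>
  have "card (touched_cables C (live c')) \<le> card ?S"
  proof (cases "W \<inter> \<Union> C = {}")
    case True
    then show ?thesis using finS
      by (intro card_mono) (auto simp: touched_cables_def c' L0_def)
  next
    case False
    then have "?S \<inter> {X, Y} \<noteq> {}" using XY by (auto simp: touched_cables_def W_def)
    then have "card (?S - {X, Y}) < card ?S" using finS by (intro psubset_card_mono) auto
    moreover have "card (touched_cables C (live c')) \<le> card (insert W (?S - {X, Y}))"
      using finS by (intro card_mono) (auto simp: touched_cables_def c' L0_def)
    moreover have "\<dots> \<le> card (?S - {X, Y}) + 1" using finS by (simp add: card_insert_if)
    ultimately show ?thesis by linarith
  qed
  then have touched': "card (touched_cables C (live c')) < b" using touched_card by linarith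
  have "W \<noteq> {}" using live_nonempty XY by (auto simp: W_def)
  then have "card Z \<le> 1" using cable_rep_card(2)[OF forest] by (auto simp: Z_def)
  then have bag: "card (R \<union> Z) \<le> b"
    using card_Un_le[of R Z] card_anchor(2)[of C] touched_card unfolding R_def by linarith
  have RV: "R \<subseteq> \<Union> (set Bs)" "R \<subseteq> last Bs"
    using anchor_last last_in_set[OF bags_nonempty] unfolding R_def by blast+
  \<comment> \<open>The common neighbour may already occur in bags. If it is touched, it is born and
    hence alone in a live cable; if not, it still represents some cable. In both cases it has stayed
    in the anchor.\<close>
  have ZU: "z \<in> R" if "z \<in> Z" "z \<in> \<Union> (set Bs)" for z
  proof (cases "z \<in> \<Union> C")
    case True
    then have "{z} \<in> live c" using Z[OF that(1)] C_born by blast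
    then show ?thesis using singleton_rep that unfolding R_def by blast
  next
    case False
    then show ?thesis using that bags_sub unfolding R_def by blast
  qed
  have "sweep G c' b C (Bs @ [R \<union> Z])"
  proof (rule sweep_extend[OF fc', where S = "{R \<union> Z}"])
    show "C - placed c' \<subseteq> live c'"
    proof
      fix e assume e: "e \<in> C - placed c'"
      then have eL: "e \<in> live c" "e \<in> edges G" using C_live C_edges by (auto simp: c')
      \<comment> \<open>Otherwise the unplaced edge \<open>{p, q}\<close> lies inside the cable
        \<open>W\<close>, which is not this edge, and \<open>q\<close> would have to be adjacent to
        itself.\<close>
      have "e \<notin> {X, Y}"
      proof
        assume eXY: "e \<in> {X, Y}"
        obtain p where p: "p \<in> e" using live_nonempty eL by blast
        obtain q where q: "e = {p, q}" using edge_obtain[OF simple eL(2) p] .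
        have "p \<in> W" "q \<in> W" using eXY q by (auto simp: W_def)
        moreover have "{p, q} \<notin> placed c'" "{p, q} \<in> edges G" using e eL q by auto
        ultimately have "W = {p, q} \<or> (\<forall>y\<in>W. {y, q} \<in> edges G)"
          using unplaced_edge_of_multicable[OF fc' compl[folded c'_def], of W p q] cardW c' by auto
        moreover have "W \<noteq> {p, q}" using W \<open>{p, q} \<in> edges G\<close> by (auto simp: W_def)
        ultimately have "{q, q} \<in> edges G" using \<open>q \<in> W\<close> by blast
        then show False using edge_neq[OF simple] by blast
      qed
      then show "e \<in> live c'" using eL by (auto simp: c' L0_def)
    qed
    show "contiguous (Bs @ [R \<union> Z])"
      by (rule contiguous_snoc[OF bags_contiguous bags_nonempty]) (use ZU RV in blast)
    have "Z \<subseteq> verts G"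
      using Z \<open>W \<noteq> {}\<close> edge_subset_verts[OF simple] by blast
    then have "R \<union> Z \<subseteq> verts G" using RV(1) bags_verts by blast
    then show "card B \<le> b \<and> B \<subseteq> verts G \<and> B \<subseteq> anchor G C (live c') \<union> \<Union> C"
      if "B \<in> {R \<union> Z}" for B using that bag RR' ZR' by auto
    show "anchor G C (live c) \<subseteq> anchor G C (live c') \<union> \<Union> C" using RR' by (simp add: R_def)
    show "\<exists>B\<in>set (Bs @ [R \<union> Z]). e \<subseteq> B" if v: "v \<in> \<Union> C" "{v} \<notin> live c'"
      "v \<notin> \<Union> C \<or> {v} \<in> live c" "e \<in> edges G" "v \<in> e" for v e
    proof (cases "e \<in> C")
      case True
      then show ?thesis using C_bag by auto
    next
      case False
      have vL: "{v} \<in> live c" using v by blast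
      then have vW: "v \<in> W" using v(2) by (auto simp: c' L0_def W_def)
      obtain z where z: "e = {v, z}" using edge_obtain[OF simple v(4,5)] .
      then have "\<forall>y\<in>W. {y, z} \<in> edges G" using future[OF vW, of z] v(4) False by blast
      moreover have "W \<inter> \<Union> C \<noteq> {}" using vW v(1) by blast
      ultimately have "z \<in> Z" using vW False z cardW by (auto simp: Z_def mem_cable_rep_multi)
      moreover have "v \<in> R" using singleton_rep[OF vL] v(1) by (simp add: R_def)
      ultimately show ?thesis using z by auto
    qed
    show "card (touched_cables C (live c')) < b" by (rule touched')
  qed (use placed_C C_edges R' in \<open>auto simp: c'\<close>)
  then show ?thesis unfolding c'_def by blast
qed

text \<open>First the new set of representatives becomes a bag, then each leaf that needs one gets a
  bag of its own; fewer than \<open>b\<close> live cables leave room for one leaf. Completion before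
  the move shows that these leaves are fresh, completion after it that the leaves of a larger
  \<open>Y\<close> are finished.\<close>

lemma sweep_block_star:
  assumes u: "{u} \<in> live c" and Y: "Y \<in> live c" "Y \<noteq> {u}"
    and adj: "block_edges {u} Y \<subseteq> edges G" and cost: "card (live c) < b"
    and c': "c' = c\<lparr>placed := placed c \<union> block_edges {u} Y\<rparr>"
    and fc': "forest_config G c'" and compl: "completes G c ms" "completes G c' ms'"
  shows "\<exists>C' Bs'. sweep G c' b C' Bs'"
proof -
  define D where "D = block_edges {u} Y"
  define C' where "C' = C \<union> D"
  define R where "R = anchor G C (live c)"
  define R' where "R' = anchor G C' (live c)"
  \<comment> \<open>A singleton \<open>Y\<close> is its own representative, and a touched leaf of a
    larger \<open>Y\<close> is retired, so its edge to \<open>u\<close> is in an earlier bag. Only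
    the remaining leaves need new bags.\<close>
  define Y' where "Y' = (if card Y = 1 then {} else Y - \<Union> C)"
  have c'_simps: "live c' = live c" "placed c' = placed c \<union> D" by (simp_all add: c' D_def)
  have uY: "u \<notin> Y" using live_disjoint[OF u Y(1), of u] Y(2) by blast
  have mem_D: "{u, y} \<in> D" if "y \<in> Y" for y using that by (auto simp: D_def block_edges_def)
  have uy: "{u, y} \<in> edges G" if "y \<in> Y" for y using mem_D[OF that] adj by (auto simp: D_def)
  have "Y \<noteq> {}" using live_nonempty[OF Y(1)] .
  then have D_un: "\<Union> D = insert u Y" by (auto simp: D_def block_edges_def)
  have C'_un: "\<Union> C' = \<Union> C \<union> insert u Y" by (auto simp: C'_def D_un)
  have disj: "V \<inter> insert u Y = {}" if "V \<in> live c" "V \<noteq> {u}" "V \<noteq> Y" for V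
    using that live_disjoint[of V "{u}" u] live_disjoint[of V Y] u Y by blast
  have common: "z = u" if multi: "card Y \<noteq> 1" and all: "\<forall>y\<in>Y. {y, z} \<in> edges G" for z
  proof -
    obtain y where y: "y \<in> Y" using \<open>Y \<noteq> {}\<close> by blast
    obtain y' where y': "y' \<in> Y" "y' \<noteq> y" using card_neq_1_obtain[OF multi y] .
    show ?thesis
      by (rule forest_common_neighbour_unique[OF forest y'(2)])
        (use all y y' uy[of y] uy[of y'] in \<open>simp_all add: insert_commute[of u]\<close>)
  qed
  have uR': "u \<in> R'" unfolding R'_def by (rule anchorI[OF u]) (auto simp: C'_un)
  have single_R': "Y \<subseteq> R'" if single: "card Y = 1"
  proof -
    obtain y where "Y = {y}" using card_1_singletonE[OF single] .
    then show ?thesis unfolding R'_def using Y(1) C'_un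
      by (auto intro!: anchorI[of "{y}"])
  qed
  have RR': "R \<subseteq> R'"
  proof
    fix v assume "v \<in> R"
    then obtain V where V: "V \<in> live c" "V \<inter> \<Union> C \<noteq> {}" "v \<in> cable_rep G C V"
      by (auto simp: R_def mem_anchor)
    have V': "V \<inter> \<Union> C' \<noteq> {}" using V(2) C'_un by blast
    consider "V = {v}" | "V = Y" "card V \<noteq> 1" | "V \<noteq> Y" "V \<noteq> {u}"
      using V(3) by (cases "card V = 1") (auto simp: card_1_singleton_iff)
    then show "v \<in> R'"
    proof cases
      case 1
      then show ?thesis unfolding R'_def using V(1) V' by (intro anchorI[of V]) auto
    next
      case 2
      then have "v = u" using V(3) common[of v] by (auto simp: mem_cable_rep_multi)
      then show ?thesis using uR' by simp
    next
      case 3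
      then have "cable_rep G C' V = cable_rep G C V"
        unfolding C'_def using disj[OF V(1)] D_un by (intro cable_rep_Un_disjoint) auto
      then show ?thesis unfolding R'_def using V V' by (intro anchorI[of V]) auto
    qed
  qed
  have R'R: "R' \<subseteq> R \<union> {u} \<union> (if card Y = 1 then Y else {})"
  proof
    fix v assume "v \<in> R'"
    then obtain V where V: "V \<in> live c" "V \<inter> \<Union> C' \<noteq> {}" "v \<in> cable_rep G C' V"
      by (auto simp: R'_def mem_anchor)
    consider "V = {u}" | "V = Y" | "V \<noteq> Y" "V \<noteq> {u}" by blast
    then show "v \<in> R \<union> {u} \<union> (if card Y = 1 then Y else {})"
    proof cases
      case 1
      then show ?thesis using V(3) by simp
    next
      case 2
      show ?thesis
      proof (cases "card Y = 1")
        case True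
        then show ?thesis using V(3) 2 by (simp add: cable_rep_def)
      next
        case False
        then have "\<forall>y\<in>Y. {y, v} \<in> edges G" using V(3) 2 by (simp add: mem_cable_rep_multi)
        then have "v = u" by (rule common[OF False])
        then show ?thesis by simp
      qed
    next
      case 3
      then have "V \<inter> \<Union> D = {}" using disj[OF V(1)] D_un by simp
      then have "V \<inter> \<Union> C \<noteq> {}" "v \<in> cable_rep G C V"
        using V(2,3) cable_rep_Un_disjoint[of V D G C] unfolding C'_def by auto
      then show ?thesis using anchorI[OF V(1)] unfolding R_def by blast
    qed
  qed
  have RV: "R \<subseteq> \<Union> (set Bs)" "R \<subseteq> last Bs"
    using anchor_last last_in_set[OF bags_nonempty] unfolding R_def by blast+
  \<comment> \<open>Any new representative forms a singleton live cable, so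
    \<open>singleton_rep\<close> rules out an earlier occurrence.\<close>
  have fresh: "v \<in> R" if "v \<in> R'" "v \<in> \<Union> (set Bs)" for v
  proof (rule ccontr)
    assume "v \<notin> R"
    then have "v = u \<or> card Y = 1 \<and> v \<in> Y" using R'R that(1) by (auto split: if_splits)
    then have "{v} \<in> live c" using u Y(1) by (auto simp: card_1_singleton_iff)
    then show False using singleton_rep that(2) \<open>v \<notin> R\<close> unfolding R_def by blast
  qed
  have "touched_cables C' (live c) \<subseteq> live c" by (auto simp: touched_cables_def)
  then have "card (touched_cables C' (live c)) \<le> card (live c)" by (rule card_mono[OF finite_live])
  then have touched': "card (touched_cables C' (live c')) < b" using cost by (simp add: c'_simps)
  have cardR': "card R' < b" "finite R'"
    using card_anchor[of C'] touched' by (simp_all add: c'_simps R'_def)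
  have uYV: "insert u Y \<subseteq> verts G" using live_born u Y(1) born_verts by blast
  have "R' \<subseteq> R \<union> insert u Y" using R'R by (auto split: if_splits)
  then have R'V: "R' \<subseteq> verts G" using RV(1) bags_verts uYV by blast
  have Y'_multi: "card Y \<noteq> 1" "y \<in> Y" "y \<notin> \<Union> C" if "y \<in> Y'" for y
    using that by (auto simp: Y'_def split: if_splits)
  define Bs1 where "Bs1 = Bs @ [R']"
  have "contiguous Bs1" unfolding Bs1_def
    by (rule contiguous_snoc[OF bags_contiguous bags_nonempty]) (use fresh RV in blast)
  moreover have "finite Y'"
  proof (rule finite_subset)
    show "Y' \<subseteq> verts G" using Y'_multi(2) uYV by blast
    show "finite (verts G)" using simple by (simp add: simple_graph_def)
  qed
  moreover have "Y' \<inter> \<Union> (set Bs1) = {}"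
  proof -
    have "y \<notin> \<Union> (set Bs)" "y \<notin> R'" if "y \<in> Y'" for y
    proof -
      show "y \<notin> \<Union> (set Bs)"
        using untouched_multi_fresh[OF compl(1) Y(1)] Y'_multi[OF that] by blast
      then show "y \<notin> R'" using R'R RV(1) Y'_multi[OF that] uY by (simp; blast)
    qed
    then show ?thesis by (auto simp: Bs1_def)
  qed
  ultimately obtain Bs' where Bs': "contiguous Bs'" "Bs' \<noteq> []" "R' \<subseteq> last Bs'"
    "set Bs' = set Bs1 \<union> (\<lambda>y. insert y R') ` Y'"
    using contiguous_attach[of Y' Bs1 R'] by (auto simp: Bs1_def)
  have in_Bs': "set Bs \<subseteq> set Bs'" "R' \<in> set Bs'" "\<And>y. y \<in> Y' \<Longrightarrow> insert y R' \<in> set Bs'"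
    unfolding Bs'(4) Bs1_def by auto
  have covered: "\<exists>B\<in>set Bs'. e \<subseteq> B" if e: "e \<in> C'" for e
  proof (cases "e \<in> C")
    case True
    then show ?thesis using C_bag in_Bs'(1) by blast
  next
    case False
    then obtain y where y: "e = {u, y}" "y \<in> Y"
      using e by (auto simp: C'_def D_def block_edges_def)
    consider "card Y = 1" | "card Y \<noteq> 1" "y \<in> \<Union> C" | "card Y \<noteq> 1" "y \<notin> \<Union> C"
      by blast
    then show ?thesis
    proof cases
      case 1
      then have "e \<subseteq> R'" using single_R' uR' y by auto
      then show ?thesis using in_Bs'(2) by blast
    next
      case 2
      have "{y} \<notin> live c"
      proof
        assume "{y} \<in> live c"
        then have "Y = {y}" using live_disjoint[OF Y(1), of "{y}" y] y(2) by blast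
        then show False using 2 by simp
      qed
      then obtain B where "B \<in> set Bs" "e \<subseteq> B" using retired[OF 2(2), of e] uy y by blast
      then show ?thesis using in_Bs'(1) by blast
    next
      case 3
      then have "y \<in> Y'" using y by (simp add: Y'_def)
      moreover have "e \<subseteq> insert y R'" using uR' y by auto
      ultimately show ?thesis using in_Bs'(3) by blast
    qed
  qed
  have "sweep G c' b C' Bs'"
  proof (rule sweep_extend[OF fc', where S = "insert R' ((\<lambda>y. insert y R') ` Y')"])
    show "C' - placed c' \<subseteq> live c'" using C_live by (auto simp: C'_def c'_simps)
    show "set Bs' = set Bs \<union> insert R' ((\<lambda>y. insert y R') ` Y')" using Bs'(4) by (auto simp: Bs1_def)
    show "card B \<le> b \<and> B \<subseteq> verts G \<and> B \<subseteq> anchor G C' (live c') \<union> \<Union> C'"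
      if B: "B \<in> insert R' ((\<lambda>y. insert y R') ` Y')" for B
    proof -
      obtain A where A: "B = A \<union> R'" "A \<subseteq> Y'" "card A \<le> 1"
      proof (cases "B = R'")
        case True
        then show thesis using that[of "{}"] by simp
      next
        case False
        then obtain y where "y \<in> Y'" "B = {y} \<union> R'" using B by auto
        then show thesis using that[of "{y}"] by simp
      qed
      have "card B \<le> card A + card R'" unfolding A(1) by (rule card_Un_le)
      then have "card B \<le> b" using cardR' A(3) by linarith
      moreover have "A \<subseteq> Y" using A(2) Y'_multi by blast
      ultimately show ?thesis
        using A(1) R'V uYV C'_un by (auto simp: c'_simps R'_def)
    qed
    show "\<exists>B\<in>set Bs'. e \<subseteq> B" if v: "v \<in> \<Union> C'" "{v} \<notin> live c'"
      "v \<notin> \<Union> C \<or> {v} \<in> live c" "e \<in> edges G" "v \<in> e" for v e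
    proof -
      have vY: "v \<in> Y" using v u by (auto simp: C'_un c'_simps)
      have multi: "card Y \<noteq> 1" using v(2) vY Y(1) by (auto simp: c'_simps card_1_singleton_iff)
      obtain z where z: "e = {v, z}" using edge_obtain[OF simple v(4,5)] .
      \<comment> \<open>A missing edge at a leaf would either be \<open>Y\<close> itself, forming a
        triangle with \<open>u\<close>, or lead to a common neighbour of \<open>Y\<close>, which can
        only be \<open>u\<close>.\<close>
      have "e \<in> C'"
      proof (rule ccontr)
        assume "e \<notin> C'"
        then have "e \<notin> placed c'" using placed_C by (auto simp: c'_simps C'_def)
        then have "Y = {v, z} \<or> (\<forall>y\<in>Y. {y, z} \<in> edges G)"
          using unplaced_edge_of_multicable[OF fc' compl(2), of Y v z] Y(1) multi vY v(4) z
          by (auto simp: c'_simps)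
        moreover have "Y \<noteq> {v, z}"
        proof
          assume "Y = {v, z}"
          then show False using forest_no_triangle[OF forest, of u v z] uy v(4) z by auto
        qed
        ultimately have "z = u" using common multi by blast
        then show False using \<open>e \<notin> C'\<close> mem_D[OF vY] z by (simp add: C'_def insert_commute)
      qed
      then show ?thesis by (rule covered)
    qed
    show "\<exists>B\<in>set Bs'. e \<subseteq> B" if "e \<in> C' - C" for e using covered that by blast
    show "card (touched_cables C' (live c')) < b" by (rule touched')
  qed (use placed_C C_edges adj Bs' RR' C'_un in \<open>auto simp: c'_simps C'_def D_def R_def R'_def\<close>)
  then show ?thesis by blast
qed

text \<open>The cable is a single edge. If it is untouched, both ends are fresh and at most
  \<open>card (live c) - 1\<close> representatives are present, so a bag has room for the two. If it
  is touched, \<open>retired\<close> already provides a bag containing the edge.\<close>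

lemma sweep_clique:
  assumes legal: "legal_move G c (CliqueMove X)" and cost: "card (live c) < b"
    and compl: "completes G c (CliqueMove X # ms)"
  shows "\<exists>C' Bs'. sweep G (make_move c (CliqueMove X)) b C' Bs'"
proof -
  define c' where "c' = make_move c (CliqueMove X)"
  define C' where "C' = C \<union> {X}"
  define R where "R = anchor G C (live c)"
  have XL: "X \<in> live c" and cl: "clique_edges X \<subseteq> edges G" "\<not> clique_edges X \<subseteq> placed c"
    using legal by auto
  obtain x y where xy: "x \<in> X" "y \<in> X" "x \<noteq> y"
    using cl(2) by (auto simp: clique_edges_def)
  have X: "X = {x, y}" by (rule forest_clique_pair[OF forest cl(1) xy])
  have "clique_edges X = {X}" using xy(3) by (auto simp: clique_edges_def X insert_commute)
  then have c': "live c' = live c" "placed c' = placed c \<union> {X}" and XE: "X \<in> edges G"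
    using cl by (simp_all add: c'_def)
  have fc': "forest_config G c'" unfolding c'_def by (rule forest_config_make_move[OF legal])
  have compl': "completes G c' ms" using compl by (simp add: completes_Cons c'_def)
  have no_common: "\<not> ({x, z} \<in> edges G \<and> {y, z} \<in> edges G)" for z
    using forest_no_triangle[OF forest, of x y z] XE X by auto
  have cardX: "card X \<noteq> 1" using X xy(3) by simp
  have rep_X: "cable_rep G C'' X = {}" for C''
    using mem_cable_rep_multi[OF cardX, of _ G C''] no_common xy by blast
  have "cable_rep G C' V = cable_rep G C V" "V \<inter> \<Union> C' = V \<inter> \<Union> C"
    if "V \<in> live c" "V \<noteq> X" for V
  proof -
    have "V \<inter> X = {}" using live_disjoint[OF that(1) XL] that(2) by blast
    then show "cable_rep G C' V = cable_rep G C V" "V \<inter> \<Union> C' = V \<inter> \<Union> C"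
      using cable_rep_Un_disjoint[of V "{X}"] unfolding C'_def by auto
  qed
  then have mem: "V \<inter> \<Union> C' \<noteq> {} \<and> v \<in> cable_rep G C' V \<longleftrightarrow> V \<inter> \<Union> C \<noteq> {} \<and> v \<in> cable_rep G C V"
    if "V \<in> live c" for V v
    using that rep_X by (cases "V = X") simp_all
  have R': "anchor G C' (live c') = R"
    unfolding R_def c' by (rule set_eqI) (unfold mem_anchor, intro bex_cong[OF refl] mem)
  have RV: "R \<subseteq> \<Union> (set Bs)" "R \<subseteq> last Bs"
    using anchor_last last_in_set[OF bags_nonempty] unfolding R_def by blast+
  define S where "S = (if X \<inter> \<Union> C = {} then {R \<union> X} else {})"
  define Bs' where "Bs' = (if X \<inter> \<Union> C = {} then Bs @ [R \<union> X] else Bs)"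
  have Bs': "Bs' \<noteq> []" "set Bs' = set Bs \<union> S" "R \<subseteq> last Bs'"
    using bags_nonempty RV by (auto simp: Bs'_def S_def)
  have in_Bs': "set Bs \<subseteq> set Bs'" using Bs'(2) by simp
  have cont: "contiguous Bs'"
  proof (cases "X \<inter> \<Union> C = {}")
    case True
    then have "v \<notin> \<Union> (set Bs)" if "v \<in> X" for v
      using untouched_multi_fresh[OF compl XL cardX] that by blast
    then have "(R \<union> X) \<inter> \<Union> (set Bs) \<subseteq> last Bs" using RV by blast
    then show ?thesis using contiguous_snoc[OF bags_contiguous bags_nonempty] True
      by (simp add: Bs'_def)
  qed (simp add: Bs'_def bags_contiguous)
  have bag: "card (R \<union> X) \<le> b" if "X \<inter> \<Union> C = {}"
  proof -
    have "touched_cables C (live c) \<subseteq> live c - {X}" using that by (auto simp: touched_cables_def)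
    then have "card (touched_cables C (live c)) \<le> card (live c - {X})" by (intro card_mono) auto
    also have "\<dots> = card (live c) - 1" using XL by simp
    finally have "card R \<le> card (live c) - 1" using card_anchor(2)[of C] by (simp add: R_def)
    moreover have "0 < card (live c)" using XL by (auto simp: card_gt_0_iff)
    moreover have "card X = 2" using X xy(3) by simp
    ultimately show ?thesis using cost card_Un_le[of R X] by linarith
  qed
  have covered: "\<exists>B\<in>set Bs'. e \<subseteq> B" if e: "e \<in> C'" for e
  proof -
    consider "e \<in> C" | "e = X" "X \<inter> \<Union> C = {}" | v where "e = X" "v \<in> X" "v \<in> \<Union> C"
      using e by (auto simp: C'_def)
    then show ?thesis
    proof cases
      case 1
      then show ?thesis using C_bag in_Bs' by blast
    next
      case 2
      then have "R \<union> X \<in> set Bs'" by (simp add: Bs'_def)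
      then show ?thesis using 2 by blast
    next
      case 3
      have "{v} \<notin> live c"
      proof
        assume "{v} \<in> live c"
        then have "{v} = X" using live_disjoint[OF _ XL, of "{v}" v] 3 by blast
        then show False using cardX by auto
      qed
      then obtain B where "B \<in> set Bs" "e \<subseteq> B" using retired[OF 3(3), of e] 3 XE by blast
      then show ?thesis using in_Bs' by blast
    qed
  qed
  have "sweep G c' b C' Bs'"
  proof (rule sweep_extend[OF fc' _ _ _ cont Bs'(1,2)])
    show "C' - placed c' \<subseteq> live c'" using C_live by (auto simp: C'_def c')
    have "R \<union> X \<subseteq> verts G" using RV(1) bags_verts edge_subset_verts[OF simple XE] by blast
    then show "card B \<le> b \<and> B \<subseteq> verts G \<and> B \<subseteq> anchor G C' (live c') \<union> \<Union> C'" if "B \<in> S" for B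
      using that bag unfolding R' by (auto simp: S_def C'_def split: if_splits)
    show "\<exists>B\<in>set Bs'. e \<subseteq> B" if "e \<in> C' - C" for e using covered that by blast
    show "\<exists>B\<in>set Bs'. e \<subseteq> B" if v: "v \<in> \<Union> C'" "{v} \<notin> live c'"
      "v \<notin> \<Union> C \<or> {v} \<in> live c" "e \<in> edges G" "v \<in> e" for v e
    proof -
      have vX: "v \<in> X" using v by (auto simp: C'_def c')
      obtain z where z: "e = {v, z}" using edge_obtain[OF simple v(4,5)] .
      have "e \<in> C'"
      proof (rule ccontr)
        assume "e \<notin> C'"
        then have "e \<notin> placed c'" using placed_C by (auto simp: c' C'_def)
        then have "X = {v, z} \<or> (\<forall>u\<in>X. {u, z} \<in> edges G)"
          using unplaced_edge_of_multicable[OF fc' compl', of X v z] XL cardX vX v(4) z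
          by (auto simp: c')
        moreover have "X \<noteq> {v, z}" using \<open>e \<notin> C'\<close> z by (auto simp: C'_def)
        ultimately show False using no_common[of z] xy by blast
      qed
      then show ?thesis by (rule covered)
    qed
    have "touched_cables C' (live c') \<subseteq> live c" by (auto simp: touched_cables_def c')
    then have "card (touched_cables C' (live c')) \<le> card (live c)" by (rule card_mono[OF finite_live])
    then show "card (touched_cables C' (live c')) < b" using cost by linarith
  qed (use placed_C C_edges XE Bs'(3) R' R_def in \<open>auto simp: c' C'_def\<close>)
  then show ?thesis unfolding c'_def by blast
qed

text \<open>Halving the cost rounds down: with \<open>l\<close> live cables, block and clique moves
  give \<open>l < b\<close>, whereas a fold of cost \<open>2 * l - 1\<close> only gives
  \<open>l \<le> b\<close>.\<close>

lemma sweep_make_move: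
  assumes compl: "completes G c (m # ms)" and cost: "move_cost c m div 2 < b"
  shows "\<exists>C' Bs'. sweep G (make_move c m) b C' Bs'"
proof -
  have legal: "legal_move G c m" and compl': "completes G (make_move c m) ms"
    using compl by (simp_all add: completes_Cons)
  show ?thesis
  proof (cases m)
    case (BirthMove S)
    then show ?thesis using sweep_birth legal by blast
  next
    case (FoldMove X Y)
    have "card (live c) \<le> b" using cost FoldMove by simp
    then show ?thesis using sweep_fold_edge sweep_fold_nonedge legal compl' FoldMove by blast
  next
    case (BlockMove X Y)
    then have XY: "X \<in> live c" "Y \<in> live c" "X \<noteq> Y" "block_edges X Y \<subseteq> edges G"
      using legal by auto
    have fc': "forest_config G (make_move c m)" by (rule forest_config_make_move[OF legal])
    have cost': "card (live c) < b" using cost BlockMove by simp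
    obtain x y where "x \<in> X" "y \<in> Y" using live_nonempty XY by blast
    \<comment> \<open>One side of the block is the centre of a star; the two orientations are
      symmetric.\<close>
    then have "X = {x} \<or> Y = {y}"
      using forest_block_singleton[OF forest XY(4), of x y] by (auto simp: card_1_singleton_iff)
    then show ?thesis
    proof
      assume X: "X = {x}"
      show ?thesis
        by (rule sweep_block_star[of x Y, OF _ _ _ _ cost' _ fc' compl compl'])
          (use XY X BlockMove in auto)
    next
      assume Y: "Y = {y}"
      show ?thesis
        by (rule sweep_block_star[of y X, OF _ _ _ _ cost' _ fc' compl compl'])
          (use XY Y BlockMove in \<open>auto simp: block_edges_commute[of X]\<close>)
    qed
  next
    case (CliqueMove X)
    then show ?thesis using sweep_clique legal compl cost by simp
  next
    case (CloseMove X)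
    then show ?thesis using sweep_close legal by blast
  qed
qed

end

section \<open>From the sweep to a path decomposition\<close>

lemma sweep_final:
  assumes "sweep G c b C Bs" "completes G c ms" "\<forall>k\<in>set (play_costs c ms). k div 2 < b"
  shows "\<exists>C' Bs'. sweep G \<lparr>born = verts G, live = {}, placed = edges G\<rparr> b C' Bs'"
  using assms
proof (induction ms arbitrary: c C Bs)
  case Nil
  then show ?case by (auto simp: completes_def)
next
  case (Cons m ms)
  interpret sweep G c b C Bs by fact
  obtain C' Bs' where "sweep G (make_move c m) b C' Bs'"
    using sweep_make_move[OF Cons.prems(2)] Cons.prems(3) by auto
  then show ?case using Cons.IH Cons.prems(2,3) by (auto simp: completes_Cons)
qed

lemma sweep_initial:
  assumes "forest G" "0 < b"
  shows "sweep G initial_config b {} [{}]"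
  using assms
  by unfold_locales (auto simp: initial_config_def anchor_def touched_cables_def contiguous_def)

lemma pathwidth_le_div_2:
  assumes "forest G" "completes G initial_config ms"
    and "\<forall>k\<in>set (play_costs initial_config ms). k \<le> w"
  shows "pathwidth G \<le> w div 2"
proof -
  \<comment> \<open>\<open>b\<close> bounds the bag sizes; the width of a decomposition is one
    less.\<close>
  define b where "b = w div 2 + 1"
  have "\<forall>k\<in>set (play_costs initial_config ms). k div 2 < b"
    using assms(3) by (auto simp: b_def less_Suc_eq_le intro: div_le_mono)
  then obtain C Bs where "sweep G \<lparr>born = verts G, live = {}, placed = edges G\<rparr> b C Bs"
    using sweep_final[OF sweep_initial[OF assms(1)] assms(2), of b] by (auto simp: b_def)
  then interpret sweep G "\<lparr>born = verts G, live = {}, placed = edges G\<rparr>" b C Bs .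
  \<comment> \<open>At the end all edges are covered, so the vertices still in no bag are isolated
    and get singleton bags.\<close>
  have "finite (verts G - \<Union> (set Bs))" using simple by (simp add: simple_graph_def)
  then obtain Bs' where Bs': "contiguous Bs'" "Bs' \<noteq> []"
    "set Bs' = set Bs \<union> (\<lambda>v. {v}) ` (verts G - \<Union> (set Bs))"
    using contiguous_attach[of "verts G - \<Union> (set Bs)" Bs "{}"] bags_contiguous bags_nonempty by auto
  have "\<Union> (set Bs') = verts G" using Bs'(3) bags_verts by auto
  moreover have "\<exists>B\<in>set Bs'. e \<subseteq> B" if "e \<in> edges G" for e
    using that C_bag[of e] placed_C Bs'(3) by auto
  ultimately have "path_decomposition G Bs'"
    using Bs'(1,2) unfolding path_decomposition_def contiguous_def by blast
  then have "pathwidth G \<le> decomposition_width Bs'"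
    unfolding pathwidth_def by (intro Least_le) blast
  moreover have "\<forall>B\<in>set Bs'. card B \<le> b" using Bs'(3) bag_card by (auto simp: b_def)
  then have "Max (card ` set Bs') \<le> b" using Bs'(2) by simp
  ultimately show ?thesis by (simp add: decomposition_width_def b_def)
qed

section \<open>Linear split-free width\<close>

lemma legal_play_snoc:
  "legal_play G c ms \<Longrightarrow> legal_move G (foldl make_move c ms) m \<Longrightarrow> legal_play G c (ms @ [m])"
  by (induction ms arbitrary: c) auto

definition reachable :: "'a ugraph \<Rightarrow> 'a config \<Rightarrow> bool" where
  "reachable G c \<longleftrightarrow> (\<exists>ms. legal_play G initial_config ms \<and> foldl make_move initial_config ms = c)"

lemma reachable_make_move:
  assumes "reachable G c" "legal_move G c m"
  shows "reachable G (make_move c m)"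
proof -
  obtain ms where "legal_play G initial_config ms" "foldl make_move initial_config ms = c"
    using assms(1) by (auto simp: reachable_def)
  then show ?thesis using assms(2) legal_play_snoc unfolding reachable_def
    by (intro exI[of _ "ms @ [m]"]) auto
qed

text \<open>Bear every vertex as its own cable, place the edges one at a time by blocks, then close
  everything. This ensures that the \<open>LEAST\<close> in \<open>lsfw\<close> is attained by some
  play.\<close>

lemma simple_graph_constructible:
  assumes "simple_graph G"
  obtains ms where "constructs ms G"
proof -
  let ?single = "\<lambda>v. {v}"
  have fin: "finite (verts G)" using assms by (simp add: simple_graph_def)
  then have finE: "finite (edges G)"
    using assms by (intro finite_subset[of "edges G" "Pow (verts G)"]) (auto simp: simple_graph_def)
  have "reachable G \<lparr>born = A, live = ?single ` A, placed = {}\<rparr>" if "A \<subseteq> verts G" for A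
    using finite_subset[OF that fin] that
  proof (induction A rule: finite_induct)
    case empty
    then show ?case by (auto simp: reachable_def initial_config_def intro!: exI[of _ "[]"])
  next
    case (insert v A)
    then have "reachable G \<lparr>born = A, live = ?single ` A, placed = {}\<rparr>" by blast
    then show ?case using reachable_make_move[of G _ "BirthMove {v}"] insert by fastforce
  qed
  then have births: "reachable G \<lparr>born = verts G, live = ?single ` verts G, placed = {}\<rparr>" by blast
  have "reachable G \<lparr>born = verts G, live = ?single ` verts G, placed = E\<rparr>" if "E \<subseteq> edges G" for E
    using finite_subset[OF that finE] that
  proof (induction E rule: finite_induct)
    case empty
    then show ?case using births by simp
  next
    case (insert e E)
    let ?c = "\<lparr>born = verts G, live = ?single ` verts G, placed = E\<rparr>"
    obtain x y where e: "e = {x, y}" "x \<noteq> y"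
      using card_edge[OF assms, of e] insert.prems by (auto simp: card_2_iff)
    have block: "block_edges {x} {y} = {e}" by (auto simp: block_edges_def e)
    have "x \<in> verts G" "y \<in> verts G"
      using edge_subset_verts[OF assms, of e] insert.prems e by auto
    then have "legal_move G ?c (BlockMove {x} {y})" using insert e by (simp add: block)
    moreover have "reachable G ?c" using insert by simp
    ultimately have "reachable G (make_move ?c (BlockMove {x} {y}))"
      by (intro reachable_make_move)
    then show ?case by (simp add: block)
  qed
  then have blocks: "reachable G \<lparr>born = verts G, live = ?single ` verts G, placed = edges G\<rparr>" by blast
  have "reachable G \<lparr>born = verts G, live = ?single ` (verts G - A), placed = edges G\<rparr>"
    if "A \<subseteq> verts G" for A
    using finite_subset[OF that fin] that
  proof (induction A rule: finite_induct)
    case empty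
    then show ?case using blocks by simp
  next
    case (insert v A)
    let ?c = "\<lparr>born = verts G, live = ?single ` (verts G - A), placed = edges G\<rparr>"
    have "reachable G (make_move ?c (CloseMove {v}))"
      using insert by (intro reachable_make_move) auto
    moreover have "?single ` (verts G - A) - {{v}} = ?single ` (verts G - insert v A)" by auto
    ultimately show ?case by simp
  qed
  from this[of "verts G"] have "reachable G \<lparr>born = verts G, live = {}, placed = edges G\<rparr>" by simp
  then show thesis using that by (auto simp: reachable_def constructs_def)
qed

lemma lsfw_attained:
  assumes "simple_graph G" "verts G \<noteq> {}"
  obtains ms where "constructs ms G" "play_width ms = lsfw G"
proof -
  have "\<exists>w ms. constructs ms G \<and> play_width ms = w" using simple_graph_constructible[OF assms(1)] by blast
  then show thesis
    using that LeastI_ex[of "\<lambda>w. \<exists>ms. constructs ms G \<and> play_width ms = w"] assms(2)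
    unfolding lsfw_def by auto
qed

text \<open>An optimal play of width \<open>w\<close> gives path-width at most
  \<open>w div 2\<close>, and \<open>2 * (w div 2) \<le> w\<close>. On the empty graph, where
  \<open>lsfw\<close> is 0 by convention, the single empty bag shows that the path-width is
  0.\<close>

lemma forest_lsfw_ge:
  assumes "forest F"
  shows "2 * pathwidth F \<le> lsfw F"
proof (cases "verts F = {}")
  case True
  then have "edges F = {}"
    using assms by (auto simp: forest_def simple_graph_def)
  then have "path_decomposition F [{}]" using True by (simp add: path_decomposition_def)
  moreover have "decomposition_width [{}] = 0" by (simp add: decomposition_width_def)
  ultimately have "pathwidth F \<le> 0" unfolding pathwidth_def by (intro Least_le) blast
  then show ?thesis by simp
next
  case False
  have "simple_graph F" using assms by (simp add: forest_def)
  then obtain ms where ms: "constructs ms F" "play_width ms = lsfw F"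
    using lsfw_attained False by blast
  have "completes F initial_config ms" using ms(1) by (simp add: constructs_def completes_def)
  moreover have "\<forall>k\<in>set (play_costs initial_config ms). k \<le> lsfw F"
    unfolding ms(2)[symmetric] play_width_def by simp
  ultimately show ?thesis using pathwidth_le_div_2[OF assms] by fastforce
qed

theorem corollary4p2:
  shows "(\<forall>N::int. \<exists>T::nat ugraph. tree T \<and> int (lsfw T) - int (sfw T) \<ge> N) \<and>
         (\<forall>F::'a ugraph. forest F \<longrightarrow> lsfw F \<ge> 2 * pathwidth F) \<and>
         (\<forall>T::'a ugraph. tree T \<longrightarrow> sfw T \<le> 4)"
proof (intro conjI allI impI)
  fix N :: int
  \<comment> \<open>Doubling this path-width bound and subtracting at most 4 for \<open>sfw\<close>
    leaves at least \<open>N\<close>.\<close>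
  obtain M where M: "0 < M" "nat N + 4 \<le> pathwidth (heap_tree M)"
    using pathwidth_heap_tree_unbounded by blast
  have T: "tree (heap_tree M)" using M(1) by (rule tree_heap_tree)
  then have "2 * pathwidth (heap_tree M) \<le> lsfw (heap_tree M)"
    by (intro forest_lsfw_ge) (simp add: tree_def)
  then have "N \<le> int (lsfw (heap_tree M)) - int (sfw (heap_tree M))"
    using M(2) sfw_tree_le_4[OF T] by linarith
  then show "\<exists>T::nat ugraph. tree T \<and> N \<le> int (lsfw T) - int (sfw T)" using T by blast
qed (simp_all add: forest_lsfw_ge sfw_tree_le_4)

end
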